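(* Let $A$ be a unital C*-algebra, let $\mathcal{C}(A)$ be the poset of unital commutative C*-subalgebras of $A$ with the Alexandrov topology, let $\underline{\Sigma}$ be the internal (pointfree) Gelfand spectrum of the internal commutative C*-algebra $\underline{A}$ in $\mathrm{Sh}(\mathcal{C}(A))$, and let $\Sigma=\coprod_{C\in\mathcal{C}(A)}\Sigma(C)$ be topologized as described in the context. Then the external description of the pointfree space $\underline{\Sigma}$ may be identified with the canonical projection $$\pi:\Sigma\to\mathcal{C}(A),\qquad \pi(\sigma)=C \text{ for } \sigma\in\Sigma(C),$$ where $\Sigma$ and $\mathcal{C}(A)$ are ordinary (rather than pointfree) topological spaces. That is, $\pi$ is continuous, and the internal frame $\mathcal{O}(\underline{\Sigma})$ is isomorphic, as an internal frame in $\mathrm{Sh}(\mathcal{C}(A))$ (i.e. by an isomorphism of sheaves all of whose components are order isomorphisms), to the sheaf $$U\mapsto\{V\in\mathcal{O}(\Sigma)\mid V\subseteq\pi^{-1}(U)\},\qquad U\in\mathcal{O}(\mathcal{C}(A)),$$ ordered by inclusion, with restriction maps $V\mapsto V\cap\pi^{-1}(U')$ for $U'\subseteq U$; in particular $\mathcal{O}(\underline{\Sigma})(\mathcal{C}(A))\cong\mathcal{O}(\Sigma)$ as frames.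
   Context: **Poset and sheaf.** $\mathcal{C}(A)$ is the set of all unital commutative C*-subalgebras of $A$ (containing the unit of $A$), ordered by inclusion, with the Alexandrov topology: open sets are the upward closed sets. The sets $\mathop{\uparrow} C=\{D\in\mathcal{C}(A)\mid D\supseteq C\}$ form a basis. $\mathcal{O}(X)$ denotes the frame of open sets of a space $X$. A sheaf on $\mathcal{C}(A)$ is determined by its values on the sets $\mathop{\uparrow}C$, and $\mathrm{Sh}(\mathcal{C}(A))$ is thus identified with the category of functors $\mathcal{C}(A)\to\mathbf{Sets}$. The sheaf $\underline{A}$ is given by $\underline{A}(\mathop{\uparrow}C)=C$, with the inclusions $C\hookrightarrow D$ as restriction maps for $C\subseteq D$. It is an internal commutative C*-algebra in $\mathrm{Sh}(\mathcal{C}(A))$. **Internal Gelfand spectrum.** The constructive Gelfand spectrum of a unital commutative C*-algebra $B$ is the pointfree space (locale) whose frame is (up to isomorphism) $\mathrm{RIdl}(L_B)$, defined as follows. On the positive cone $B^+$ put $a\preccurlyeq b$ iff $a\leq nb$ for some $n\in\mathbb{N}$, and $a\approx b$ iff $a\preccurlyeq b$ and $b\preccurlyeq a$. Then $L_B=B^+/\!\approx$ is a lattice, with order $[a]\leqslant[b]$ iff $a\preccurlyeq b$. For selfadjoint $a\in B$ with positive part $a^+$ put $D_a=[a^+]\in L_B$. Write $D_b\ll D_a$ iff $D_b\leqslant D_{a-q}$ for some rational $q>0$. An ideal of $L_B$ is a nonempty lower closed subset closed under binary joins. An ideal $I$ is regular if, for every $D_a\in L_B$, ($D_b\in I$ for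 all $D_b\ll D_a$) implies $D_a\in I$. $\mathrm{RIdl}(L_B)$ is the frame of regular ideals ordered by inclusion. The internal Gelfand spectrum $\underline{\Sigma}$ of $\underline{A}$ is the result of interpreting this construction for $\underline{A}$ internally in $\mathrm{Sh}(\mathcal{C}(A))$. Concretely, the internal lattice is the sheaf $\underline{L}_{\underline{A}}$ with $\underline{L}_{\underline{A}}(\mathop{\uparrow}C)=L_C$ and maps $L_C\to L_D$, $D_a\mapsto D_a$ for $C\subseteq D$, and the internal frame $\mathcal{O}(\underline{\Sigma})$ is the sheaf $$U\mapsto\{\underline{F}\text{ a subsheaf of }\underline{L}_{\underline{A}}|_U\;\mid\;\underline{F}(\mathop{\uparrow}C)\in\mathrm{RIdl}(L_C)\text{ for all }C\in U\},\quad U\in\mathcal{O}(\mathcal{C}(A)),$$ ordered by inclusion, with restriction maps given by restricting subsheaves. **The space $\Sigma$.** For $C\in\mathcal{C}(A)$, $\Sigma(C)$ is the usual Gelfand spectrum (the characters of $C$ with the weak*-topology). $\Sigma=\coprod_{C\in\mathcal{C}(A)}\Sigma(C)$ as a set. A subset $\mathcal{U}\subseteq\Sigma$, with $\mathcal{U}_C:=\mathcal{U}\cap\Sigma(C)$, is open iff for all $C\in\mathcal{C}(A)$: (1) $\mathcal{U}_C$ is open in $\Sigma(C)$; (2) for all $D\supseteq C$, if $\lambda\in\mathcal{U}_C$ and $\lambda'\in\Sigma(D)$ satisfies $\lambda'|_C=\lambda$, then $\lambda'\in\mathcal{U}_D$. **External description.** Let $X$ be a topological space and $\underline{Y}$ a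 pointfree space in $\mathrm{Sh}(X)$, i.e. one given by an internal frame $\mathcal{O}(\underline{Y})$. Its external description is the map of pointfree spaces $\pi:Y\to X$ in $\mathbf{Sets}$ (i.e. a frame map $\pi^*:\mathcal{O}(X)\to\mathcal{O}(Y)$), with $\mathcal{O}(Y)=\mathcal{O}(\underline{Y})(X)$, from which $\underline{Y}$ is recovered up to isomorphism as the sheaf $U\mapsto\{V\in\mathcal{O}(Y)\mid V\leq\pi^*(U)\}$. When $\pi$ is a continuous map of ordinary spaces, $\pi^*=\pi^{-1}$. *)

theory Defs
  imports "HOL-Analysis.Analysis" "HOL-Algebra.Complete_Lattice"
begin

section \<open>Unital C*-algebras and their commutative subalgebras\<close>

text \<open>The class \<open>monoid_mult\<close> (rather than \<open>ring_1\<close>) supplies the unit, so that the zero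
  algebra is not excluded. The norm of the unit is not postulated; it follows from the C*-identity.\<close>

class unital_cstar_algebra = real_normed_algebra + banach + monoid_mult +
  fixes scaleC :: "complex \<Rightarrow> 'a \<Rightarrow> 'a"  (infixr \<open>*\<^sub>C\<close> 75)
    and adj :: "'a \<Rightarrow> 'a"
  assumes scaleC_add_right: "c *\<^sub>C (x + y) = c *\<^sub>C x + c *\<^sub>C y"
    and scaleC_add_left: "(c + d) *\<^sub>C x = c *\<^sub>C x + d *\<^sub>C x"
    and scaleC_scaleC: "c *\<^sub>C d *\<^sub>C x = (c * d) *\<^sub>C x"
    and scaleR_scaleC: "r *\<^sub>R x = complex_of_real r *\<^sub>C x"
    and mult_scaleC_left: "(c *\<^sub>C x) * y = c *\<^sub>C (x * y)"
    and mult_scaleC_right: "x * (c *\<^sub>C y) = c *\<^sub>C (x * y)"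
    and norm_scaleC: "norm (c *\<^sub>C x) = cmod c * norm x"
    and adj_adj: "adj (adj x) = x"
    and adj_add: "adj (x + y) = adj x + adj y"
    and adj_scaleC: "adj (c *\<^sub>C x) = cnj c *\<^sub>C adj x"
    and adj_mult: "adj (x * y) = adj y * adj x"
    and cstar_identity: "norm (adj x * x) = (norm x)\<^sup>2"

definition commutative_subalgebra :: "'a::unital_cstar_algebra set \<Rightarrow> bool" where
  "commutative_subalgebra C \<longleftrightarrow>
     1 \<in> C \<and>
     (\<forall>x\<in>C. \<forall>y\<in>C. x + y \<in> C) \<and>
     (\<forall>c. \<forall>x\<in>C. c *\<^sub>C x \<in> C) \<and>
     (\<forall>x\<in>C. \<forall>y\<in>C. x * y \<in> C) \<and>
     (\<forall>x\<in>C. adj x \<in> C) \<and>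
     closed C \<and>
     (\<forall>x\<in>C. \<forall>y\<in>C. x * y = y * x)"

text \<open>The poset \<open>\<C>(A)\<close>; the algebra \<open>A\<close> is the whole type.\<close>

definition contexts :: "'a::unital_cstar_algebra itself \<Rightarrow> 'a set set" where
  "contexts A = {C. commutative_subalgebra C}"

definition alexandrov :: "'a set set \<Rightarrow> 'a set topology" where
  "alexandrov P = topology (\<lambda>U. U \<subseteq> P \<and> (\<forall>C\<in>U. \<forall>D\<in>P. C \<subseteq> D \<longrightarrow> D \<in> U))"

lemma openin_alexandrov:
  "openin (alexandrov P) U \<longleftrightarrow> U \<subseteq> P \<and> (\<forall>C\<in>U. \<forall>D\<in>P. C \<subseteq> D \<longrightarrow> D \<in> U)"
proof -
  have "istopology (\<lambda>U. U \<subseteq> P \<and> (\<forall>C\<in>U. \<forall>D\<in>P. C \<subseteq> D \<longrightarrow> D \<in> U))"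
    unfolding istopology_def
  proof (rule conjI; intro allI impI)
    fix S T
    assume S: "S \<subseteq> P \<and> (\<forall>C\<in>S. \<forall>D\<in>P. C \<subseteq> D \<longrightarrow> D \<in> S)"
      and T: "T \<subseteq> P \<and> (\<forall>C\<in>T. \<forall>D\<in>P. C \<subseteq> D \<longrightarrow> D \<in> T)"
    show "S \<inter> T \<subseteq> P \<and> (\<forall>C\<in>S \<inter> T. \<forall>D\<in>P. C \<subseteq> D \<longrightarrow> D \<in> S \<inter> T)"
    proof (rule conjI; (intro ballI impI)?)
      show "S \<inter> T \<subseteq> P"
        using S by (simp add: le_infI1)
    next
      fix C D assume "C \<in> S \<inter> T" "D \<in> P" "C \<subseteq> D"
      then show "D \<in> S \<inter> T"
        using S[THEN conjunct2, rule_format, of C D] T[THEN conjunct2, rule_format, of C D] by simp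
    qed
  next
    fix K
    assume K: "\<forall>S\<in>K. S \<subseteq> P \<and> (\<forall>C\<in>S. \<forall>D\<in>P. C \<subseteq> D \<longrightarrow> D \<in> S)"
    show "\<Union>K \<subseteq> P \<and> (\<forall>C\<in>\<Union>K. \<forall>D\<in>P. C \<subseteq> D \<longrightarrow> D \<in> \<Union>K)"
    proof (rule conjI; (intro ballI impI)?)
      show "\<Union>K \<subseteq> P"
        using K by (simp add: Sup_le_iff)
    next
      fix C D assume "C \<in> \<Union>K" and D: "D \<in> P" "C \<subseteq> D"
      then obtain S where "S \<in> K" "C \<in> S"
        by (elim UnionE)
      with D show "D \<in> \<Union>K"
        using K[rule_format, THEN conjunct2, rule_format, of S C D] by (intro UnionI)
    qed
  qed
  then show ?thesis
    by (simp add: alexandrov_def topology_inverse')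
qed

lemma topspace_alexandrov: "topspace (alexandrov P) = P"
  unfolding topspace_def openin_alexandrov by blast


section \<open>The Gelfand spectrum as a topological space\<close>

text \<open>Functionals on \<open>C\<close> are encoded as functions that are \<open>undefined\<close> outside \<open>C\<close>.\<close>

definition characters :: "'a::unital_cstar_algebra set \<Rightarrow> ('a \<Rightarrow> complex) set" where
  "characters C = {l \<in> extensional C.
     l 1 = 1 \<and>
     (\<forall>x\<in>C. \<forall>y\<in>C. l (x + y) = l x + l y) \<and>
     (\<forall>c. \<forall>x\<in>C. l (c *\<^sub>C x) = c * l x) \<and>
     (\<forall>x\<in>C. \<forall>y\<in>C. l (x * y) = l x * l y)}"

text \<open>The weak*-topology is the topology of pointwise convergence on \<open>C\<close>.\<close>

definition gelfand_spectrum :: "'a::unital_cstar_algebra set \<Rightarrow> ('a \<Rightarrow> complex) topology" where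
  "gelfand_spectrum C = subtopology (product_topology (\<lambda>_. euclidean) C) (characters C)"

definition is_open_in_Sigma ::
    "'a::unital_cstar_algebra itself \<Rightarrow> ('a set \<times> ('a \<Rightarrow> complex)) set \<Rightarrow> bool" where
  "is_open_in_Sigma A W \<longleftrightarrow>
     W \<subseteq> Sigma (contexts A) characters \<and>
     (\<forall>C\<in>contexts A.
        openin (gelfand_spectrum C) {l. (C, l) \<in> W} \<and>
        (\<forall>D\<in>contexts A. C \<subseteq> D \<longrightarrow>
           (\<forall>l l'. (C, l) \<in> W \<and> l' \<in> characters D \<and> restrict l' C = l \<longrightarrow> (D, l') \<in> W)))"

definition Sigma_space ::
    "'a::unital_cstar_algebra itself \<Rightarrow> ('a set \<times> ('a \<Rightarrow> complex)) topology" where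
  "Sigma_space A = topology (is_open_in_Sigma A)"

lemma is_open_in_SigmaD:
  assumes "is_open_in_Sigma A W" "C \<in> contexts A" "D \<in> contexts A" "C \<subseteq> D"
    and "(C, restrict l' C) \<in> W" "l' \<in> characters D"
  shows "(D, l') \<in> W"
proof -
  have "\<forall>D\<in>contexts A. C \<subseteq> D \<longrightarrow>
      (\<forall>l l'. (C, l) \<in> W \<and> l' \<in> characters D \<and> restrict l' C = l \<longrightarrow> (D, l') \<in> W)"
    using assms(1,2) unfolding is_open_in_Sigma_def by simp
  from this[rule_format, OF assms(3,4), of "restrict l' C" l'] show ?thesis
    using assms(5,6) by simp
qed

lemma istopology_is_open_in_Sigma: "istopology (is_open_in_Sigma A)"
  unfolding istopology_def
proof (intro conjI allI impI)
  fix S T assume S: "is_open_in_Sigma A S" and T: "is_open_in_Sigma A T"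
  have eq: "{l. (C, l) \<in> S \<inter> T} = {l. (C, l) \<in> S} \<inter> {l. (C, l) \<in> T}" for C
    by blast
  show "is_open_in_Sigma A (S \<inter> T)"
    using S T unfolding is_open_in_Sigma_def eq by (simp add: openin_Int) blast
next
  fix K assume K: "\<forall>S\<in>K. is_open_in_Sigma A S"
  have eq: "{l. (C, l) \<in> \<Union>K} = (\<Union>S\<in>K. {l. (C, l) \<in> S})" for C
    by blast
  have "openin (gelfand_spectrum C) (\<Union>S\<in>K. {l. (C, l) \<in> S})" if "C \<in> contexts A" for C
    using K that by (auto simp: is_open_in_Sigma_def)
  moreover have "\<Union>K \<subseteq> Sigma (contexts A) characters"
    using K by (auto simp: is_open_in_Sigma_def)
  moreover have "(D, l') \<in> \<Union>K"
    if "C \<in> contexts A" "D \<in> contexts A" "C \<subseteq> D"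
      and "(C, l) \<in> \<Union>K" "l' \<in> characters D" "restrict l' C = l" for C D l l'
  proof -
    obtain S where "S \<in> K" "(C, l) \<in> S"
      using \<open>(C, l) \<in> \<Union>K\<close> by blast
    moreover have "is_open_in_Sigma A S"
      using K \<open>S \<in> K\<close> by blast
    ultimately have "(D, l') \<in> S"
      using is_open_in_SigmaD that by metis
    then show ?thesis
      using \<open>S \<in> K\<close> by blast
  qed
  ultimately show "is_open_in_Sigma A (\<Union>K)"
    unfolding is_open_in_Sigma_def eq by metis
qed

lemma openin_Sigma_space: "openin (Sigma_space A) W \<longleftrightarrow> is_open_in_Sigma A W"
  by (simp add: Sigma_space_def istopology_is_open_in_Sigma topology_inverse')


section \<open>The lattice of a commutative C*-algebra and its regular ideals\<close>

definition positive_cone :: "'a::unital_cstar_algebra set \<Rightarrow> 'a set" where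
  "positive_cone B = {adj b * b | b. b \<in> B}"

definition selfadjoints :: "'a::unital_cstar_algebra set \<Rightarrow> 'a set" where
  "selfadjoints B = {a \<in> B. adj a = a}"

text \<open>The positive part comes from the orthogonal decomposition \<open>a = a\<^sup>+ - a\<^sup>-\<close> into positive
  elements with \<open>a\<^sup>+ a\<^sup>- = 0\<close>; here \<open>a\<^sup>- = p - a\<close>.\<close>

definition positive_part :: "'a::unital_cstar_algebra set \<Rightarrow> 'a \<Rightarrow> 'a" where
  "positive_part B a =
     (THE p. p \<in> positive_cone B \<and> p - a \<in> positive_cone B \<and> p * (p - a) = 0)"

definition dominated :: "'a::unital_cstar_algebra set \<Rightarrow> 'a \<Rightarrow> 'a \<Rightarrow> bool" where
  "dominated B a b \<longleftrightarrow> (\<exists>n::nat. real n *\<^sub>R b - a \<in> positive_cone B)"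

definition approx_rel :: "'a::unital_cstar_algebra set \<Rightarrow> ('a \<times> 'a) set" where
  "approx_rel B = {(a, b). a \<in> positive_cone B \<and> b \<in> positive_cone B \<and>
                           dominated B a b \<and> dominated B b a}"

definition L_lattice :: "'a::unital_cstar_algebra set \<Rightarrow> 'a set gorder" where
  "L_lattice B = \<lparr>carrier = positive_cone B // approx_rel B, eq = (=),
                  le = (\<lambda>x y. \<exists>a\<in>x. \<exists>b\<in>y. dominated B a b)\<rparr>"

definition D_class :: "'a::unital_cstar_algebra set \<Rightarrow> 'a \<Rightarrow> 'a set" where
  "D_class B a = approx_rel B `` {positive_part B a}"

text \<open>\<open>way_below B b a\<close> is the relation \<open>D\<^sub>b \<lless> D\<^sub>a\<close>.\<close>

definition way_below :: "'a::unital_cstar_algebra set \<Rightarrow> 'a \<Rightarrow> 'a \<Rightarrow> bool" where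
  "way_below B b a \<longleftrightarrow>
     (\<exists>q::rat. q > 0 \<and> D_class B b \<sqsubseteq>\<^bsub>L_lattice B\<^esub> D_class B (a - of_rat q *\<^sub>R 1))"

definition lattice_ideal :: "('b, 'c) gorder_scheme \<Rightarrow> 'b set \<Rightarrow> bool" where
  "lattice_ideal L I \<longleftrightarrow>
     I \<subseteq> carrier L \<and> I \<noteq> {} \<and>
     (\<forall>x\<in>I. \<forall>y\<in>carrier L. y \<sqsubseteq>\<^bsub>L\<^esub> x \<longrightarrow> y \<in> I) \<and>
     (\<forall>x\<in>I. \<forall>y\<in>I. x \<squnion>\<^bsub>L\<^esub> y \<in> I)"

definition RIdl :: "'a::unital_cstar_algebra set \<Rightarrow> 'a set set set" where
  "RIdl B = {I. lattice_ideal (L_lattice B) I \<and>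
     (\<forall>a\<in>selfadjoints B.
        (\<forall>b\<in>selfadjoints B. way_below B b a \<longrightarrow> D_class B b \<in> I) \<longrightarrow> D_class B a \<in> I)}"

text \<open>The map \<open>L\<^sub>C \<rightarrow> L\<^sub>D\<close>, \<open>[a] \<mapsto> [a]\<close>, for \<open>C \<subseteq> D\<close>: the classes in \<open>D\<close> of the members of a
  class in \<open>C\<close> all coincide.\<close>

definition L_map :: "'a::unital_cstar_algebra set \<Rightarrow> 'a set \<Rightarrow> 'a set" where
  "L_map D x = approx_rel D `` x"


section \<open>Sheaves of posets on a topological space\<close>

record ('x, 's) poset_presheaf =
  sections :: "'x set \<Rightarrow> 's gorder"
  restr :: "'x set \<Rightarrow> 'x set \<Rightarrow> 's \<Rightarrow> 's"  \<comment> \<open>\<open>restr F U V\<close> restricts from \<open>U\<close> to \<open>V \<subseteq> U\<close>\<close>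

text \<open>A sheaf of sets with an internal partial order, that is, the order is a subsheaf of the
  product of the sheaf with itself.\<close>

locale poset_sheaf =
  fixes X :: "'x topology" and F :: "('x, 's) poset_presheaf"
  assumes partial_order_sections: "openin X U \<Longrightarrow> partial_order (sections F U)"
    and restr_closed: "\<lbrakk>openin X U; openin X V; V \<subseteq> U; s \<in> carrier (sections F U)\<rbrakk>
           \<Longrightarrow> restr F U V s \<in> carrier (sections F V)"
    and restr_mono: "\<lbrakk>openin X U; openin X V; V \<subseteq> U; s \<in> carrier (sections F U);
            t \<in> carrier (sections F U); s \<sqsubseteq>\<^bsub>sections F U\<^esub> t\<rbrakk>
           \<Longrightarrow> restr F U V s \<sqsubseteq>\<^bsub>sections F V\<^esub> restr F U V t"
    and restr_id: "\<lbrakk>openin X U; s \<in> carrier (sections F U)\<rbrakk> \<Longrightarrow> restr F U U s = s"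
    and restr_restr: "\<lbrakk>openin X U; openin X V; openin X W; W \<subseteq> V; V \<subseteq> U; s \<in> carrier (sections F U)\<rbrakk>
           \<Longrightarrow> restr F V W (restr F U V s) = restr F U W s"
    and glue: "\<lbrakk>\<And>V. V \<in> \<V> \<Longrightarrow> openin X V;
            \<And>V. V \<in> \<V> \<Longrightarrow> \<sigma> V \<in> carrier (sections F V);
            \<And>V W. \<lbrakk>V \<in> \<V>; W \<in> \<V>\<rbrakk> \<Longrightarrow> restr F V (V \<inter> W) (\<sigma> V) = restr F W (V \<inter> W) (\<sigma> W)\<rbrakk>
           \<Longrightarrow> \<exists>!t. t \<in> carrier (sections F (\<Union>\<V>)) \<and> (\<forall>V\<in>\<V>. restr F (\<Union>\<V>) V t = \<sigma> V)"
    and le_local: "\<lbrakk>\<And>V. V \<in> \<V> \<Longrightarrow> openin X V;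
            s \<in> carrier (sections F (\<Union>\<V>)); t \<in> carrier (sections F (\<Union>\<V>));
            \<And>V. V \<in> \<V> \<Longrightarrow> restr F (\<Union>\<V>) V s \<sqsubseteq>\<^bsub>sections F V\<^esub> restr F (\<Union>\<V>) V t\<rbrakk>
           \<Longrightarrow> s \<sqsubseteq>\<^bsub>sections F (\<Union>\<V>)\<^esub> t"

definition order_iso :: "'a gorder \<Rightarrow> 'b gorder \<Rightarrow> ('a \<Rightarrow> 'b) \<Rightarrow> bool" where
  "order_iso L M f \<longleftrightarrow> bij_betw f (carrier L) (carrier M) \<and>
     (\<forall>x\<in>carrier L. \<forall>y\<in>carrier L. x \<sqsubseteq>\<^bsub>L\<^esub> y \<longleftrightarrow> f x \<sqsubseteq>\<^bsub>M\<^esub> f y)"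

definition sheaf_isomorphic ::
    "'x topology \<Rightarrow> ('x, 's) poset_presheaf \<Rightarrow> ('x, 't) poset_presheaf \<Rightarrow> bool" where
  "sheaf_isomorphic X F G \<longleftrightarrow> poset_sheaf X F \<and> poset_sheaf X G \<and>
     (\<exists>\<phi>. (\<forall>U. openin X U \<longrightarrow> order_iso (sections F U) (sections G U) (\<phi> U)) \<and>
          (\<forall>U V. openin X U \<and> openin X V \<and> V \<subseteq> U \<longrightarrow>
             (\<forall>s\<in>carrier (sections F U). \<phi> V (restr F U V s) = restr G U V (\<phi> U s))))"

locale frame = complete_lattice L for L (structure) +
  assumes meet_sup_distrib: "\<lbrakk>x \<in> carrier L; S \<subseteq> carrier L\<rbrakk> \<Longrightarrow> x \<sqinter> \<Squnion>S = \<Squnion>((\<lambda>s. x \<sqinter> s) ` S)"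

text \<open>The frame operations are determined by the order, so isomorphisms of frames are order
  isomorphisms.\<close>

definition frame_isomorphic :: "'a gorder \<Rightarrow> 'b gorder \<Rightarrow> bool" where
  "frame_isomorphic L M \<longleftrightarrow> frame L \<and> frame M \<and> (\<exists>f. order_iso L M f)"

definition opens_frame :: "'y topology \<Rightarrow> 'y set gorder" where
  "opens_frame Y = \<lparr>carrier = {V. openin Y V}, eq = (=), le = (\<subseteq>)\<rparr>"

text \<open>The sheaf \<open>U \<mapsto> {V \<in> \<O>(Y) | V \<subseteq> p\<^sup>-\<^sup>1(U)}\<close> described externally by \<open>p : Y \<rightarrow> X\<close>.\<close>

definition sheaf_of_map :: "'y topology \<Rightarrow> ('y \<Rightarrow> 'x) \<Rightarrow> ('x, 'y set) poset_presheaf" where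
  "sheaf_of_map Y p =
     \<lparr>sections = (\<lambda>U. \<lparr>carrier = {V. openin Y V \<and> V \<subseteq> p -` U}, eq = (=), le = (\<subseteq>)\<rparr>),
      restr = (\<lambda>U U' V. V \<inter> p -` U')\<rparr>"


section \<open>The internal Gelfand spectrum\<close>

text \<open>Sheaves on \<open>\<C>(A)\<close> are identified with functors on the poset \<open>\<C>(A)\<close>, so a subsheaf of
  \<open>L|\<^sub>U\<close> is a family \<open>(F(\<up>C))\<close>, \<open>C \<in> U\<close>, of subsets of \<open>L\<^sub>C\<close> that is stable under the maps
  \<open>L\<^sub>C \<rightarrow> L\<^sub>D\<close>. Families are \<open>undefined\<close> outside \<open>U\<close>.\<close>

definition subsheaves_of_L ::
    "'a::unital_cstar_algebra set set \<Rightarrow> ('a set \<Rightarrow> 'a set set) set" where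
  "subsheaves_of_L U =
     {F \<in> (\<Pi>\<^sub>E C\<in>U. Pow (carrier (L_lattice C))).
        \<forall>C\<in>U. \<forall>D\<in>U. C \<subseteq> D \<longrightarrow> L_map D ` F C \<subseteq> F D}"

definition internal_spectrum ::
    "'a::unital_cstar_algebra itself \<Rightarrow> ('a set, 'a set \<Rightarrow> 'a set set) poset_presheaf" where
  "internal_spectrum A =
     \<lparr>sections = (\<lambda>U. \<lparr>carrier = {F \<in> subsheaves_of_L U. \<forall>C\<in>U. F C \<in> RIdl C}, eq = (=),
                       le = (\<lambda>F G. \<forall>C\<in>U. F C \<subseteq> G C)\<rparr>),
      restr = (\<lambda>U U' F. restrict F U')\<rparr>"

end

theory Submission
  imports Defs
begin

text \<open>For a single commutative C*-algebra \<open>C\<close>, sending a regular ideal \<open>I\<close> of \<open>L\<^sub>C\<close> to the union of the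
  cozero sets of its members, and an open set \<open>W\<close> to the ideal of all \<open>[a]\<close> whose cozero set lies in
  \<open>W\<close>, are mutually inverse order isomorphisms between \<open>RIdl(L\<^sub>C)\<close> and \<open>\<O>(\<Sigma>(C))\<close>; regularity together with
  compactness of the spectrum gives one composite, and the fact that cozero sets form a basis the other.
  Stability of a family of regular ideals under the maps \<open>L\<^sub>C \<rightarrow> L\<^sub>D\<close> is exactly the second condition
  for openness in \<open>\<Sigma>\<close>, so these isomorphisms assemble to an isomorphism of sheaves.

  From Gelfand duality this needs that an element is positive as soon as all characters are nonnegative
  on it. It is obtained without spectral theory, as an Archimedean Positivstellensatz for the cone of
  positive elements, with the cone described by the norm condition \<open>\<parallel>t - x\<parallel> \<le> t\<close>.\<close>

section \<open>Elementary properties of C*-algebras\<close>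

text \<open>Domination by multiples is in general strictly finer than inclusion of cozero sets: a
  positive element and its square root vanish together, yet no multiple of the former need dominate
  the latter. So an element whose cozero set is covered by an ideal cannot be compared with the
  ideal directly; only its truncations \<open>(a - r)^+\<close> can, and regularity passes from
  these to \<open>a\<close>. The comparison turns a pointwise inequality at all characters into an
  inequality in the algebra.

  For that, an element outside the cone needs a character that is not positive on it. Adjoining
  \<open>- a\<close> to the cone and enlarging the result maximally imitates the construction of an
  ordering of a ring. Two facts carry this: if \<open>a * q\<close> is at least one with
  \<open>q\<close> positive, then \<open>a\<close> is positive, which keeps \<open>- 1\<close> out
  of the enlarged cone; and every selfadjoint element is bounded by a multiple of the unit, which
  makes the ordering Archimedean, so that its values are real numbers. The bound obtained is only
  \<open>f a \<le> 0\<close>; strictness is recovered by shifting by a small constant, the cone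
  being closed.\<close>

lemma scaleC_zero_left [simp]: "0 *\<^sub>C (x::'a::unital_cstar_algebra) = 0"
  using scaleC_add_left[of 0 0 x] by simp

lemma scaleC_zero_right [simp]: "c *\<^sub>C (0::'a::unital_cstar_algebra) = 0"
  using scaleC_add_right[of c 0 "0::'a"] by simp

lemma scaleC_one [simp]: "1 *\<^sub>C (x::'a::unital_cstar_algebra) = x"
  using scaleR_scaleC[of 1 x] by simp

lemma scaleC_minus_left: "(- c) *\<^sub>C (x::'a::unital_cstar_algebra) = - (c *\<^sub>C x)"
  using scaleC_add_left[of "-c" c x] by (simp add: eq_neg_iff_add_eq_0)

lemma scaleC_minus_right: "c *\<^sub>C (- x::'a::unital_cstar_algebra) = - (c *\<^sub>C x)"
  using scaleC_add_right[of c "-x" x] by (simp add: eq_neg_iff_add_eq_0)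

lemma scaleC_diff_right: "c *\<^sub>C (x - y::'a::unital_cstar_algebra) = c *\<^sub>C x - c *\<^sub>C y"
  using scaleC_add_right[of c x "-y"] by (simp add: scaleC_minus_right)

lemma adj_zero [simp]: "adj (0::'a::unital_cstar_algebra) = 0"
  using adj_scaleC[of 0 "0::'a"] by simp

lemma adj_minus: "adj (- x::'a::unital_cstar_algebra) = - adj x"
  using adj_add[of "-x" x] by (simp add: eq_neg_iff_add_eq_0)

lemma adj_diff: "adj (x - y::'a::unital_cstar_algebra) = adj x - adj y"
  using adj_add[of x "-y"] by (simp add: adj_minus)

lemma adj_scaleR: "adj (r *\<^sub>R x::'a::unital_cstar_algebra) = r *\<^sub>R adj x"
  by (simp add: scaleR_scaleC adj_scaleC)

lemma adj_one [simp]: "adj (1::'a::unital_cstar_algebra) = 1"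
  using adj_mult[of "adj 1" "1::'a"] by (simp add: adj_adj)

text \<open>The C*-identity and submultiplicativity give \<open>norm y \<le> norm (adj y)\<close>
  after cancelling one factor; at \<open>adj x\<close> this is the converse inequality.\<close>

lemma norm_adj [simp]: "norm (adj (x::'a::unital_cstar_algebra)) = norm x"
proof -
  have le: "norm y \<le> norm (adj y)" for y :: 'a
  proof (cases "y = 0")
    case False
    have "norm y * norm y \<le> norm (adj y) * norm y"
      using norm_mult_ineq[of "adj y" y] by (simp add: cstar_identity power2_eq_square)
    with False show ?thesis by simp
  qed simp
  show ?thesis
    using le[of x] le[of "adj x"] by (simp add: adj_adj)
qed

text \<open>By the C*-identity the norm of the unit equals its own square. Only an inequality holds
  in general, because in the zero algebra this norm is 0.\<close>

lemma norm_one_le: "norm (1::'a::unital_cstar_algebra) \<le> 1"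
  using cstar_identity[of "1::'a"] by (auto simp: power2_eq_square)

text \<open>The adjoint is conjugate-linear over the complex numbers, but over the reals it is a
  bounded linear map.\<close>

lemma tendsto_adj: "(f \<longlongrightarrow> (x::'a::unital_cstar_algebra)) F \<Longrightarrow> ((\<lambda>n. adj (f n)) \<longlongrightarrow> adj x) F"
  by (rule bounded_linear.tendsto[OF bounded_linear_intro[where K=1]])
     (auto simp: adj_add adj_scaleR)

section \<open>The positive cone of a commutative C*-algebra\<close>

locale comm_cstar =
  fixes C :: "'a::unital_cstar_algebra set"
  assumes comm: "commutative_subalgebra C"
begin

abbreviation S :: "'a set" where "S \<equiv> selfadjoints C"
abbreviation P :: "'a set" where "P \<equiv> positive_cone C"

lemma one_C [simp]: "1 \<in> C"
  and add_C [simp]: "x \<in> C \<Longrightarrow> y \<in> C \<Longrightarrow> x + y \<in> C"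
  and scaleC_C [simp]: "x \<in> C \<Longrightarrow> c *\<^sub>C x \<in> C"
  and mult_C [simp]: "x \<in> C \<Longrightarrow> y \<in> C \<Longrightarrow> x * y \<in> C"
  and adj_C [simp]: "x \<in> C \<Longrightarrow> adj x \<in> C"
  and closed_C: "closed C"
  and commute: "x \<in> C \<Longrightarrow> y \<in> C \<Longrightarrow> x * y = y * x"
  using comm by (auto simp: commutative_subalgebra_def)

lemma scaleR_C [simp]: "x \<in> C \<Longrightarrow> r *\<^sub>R x \<in> C"
  by (simp add: scaleR_scaleC)

lemma zero_C [simp]: "0 \<in> C"
  using scaleR_C[OF one_C, of 0] by simp

lemma minus_C [simp]: "x \<in> C \<Longrightarrow> - x \<in> C"
  using scaleR_C[of x "-1"] by simp

lemma diff_C [simp]: "x \<in> C \<Longrightarrow> y \<in> C \<Longrightarrow> x - y \<in> C"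
  using add_C[of x "-y"] by simp

lemma left_commute: "x \<in> C \<Longrightarrow> y \<in> C \<Longrightarrow> x * (y * z) = y * (x * z)"
  by (metis commute mult.assoc)

lemma S_I: "x \<in> C \<Longrightarrow> adj x = x \<Longrightarrow> x \<in> S"
  by (simp add: selfadjoints_def)

lemma S_one: "1 \<in> S"
  and S_zero: "0 \<in> S"
  and S_add: "x \<in> S \<Longrightarrow> y \<in> S \<Longrightarrow> x + y \<in> S"
  and S_diff: "x \<in> S \<Longrightarrow> y \<in> S \<Longrightarrow> x - y \<in> S"
  and S_minus: "x \<in> S \<Longrightarrow> - x \<in> S"
  and S_scaleR: "x \<in> S \<Longrightarrow> r *\<^sub>R x \<in> S"
  and S_mult: "x \<in> S \<Longrightarrow> y \<in> S \<Longrightarrow> x * y \<in> S"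
  by (auto simp: selfadjoints_def adj_add adj_diff adj_minus adj_scaleR adj_mult commute)

lemma S_C: "x \<in> S \<Longrightarrow> x \<in> C"
  and S_adj: "x \<in> S \<Longrightarrow> adj x = x"
  by (simp_all add: selfadjoints_def)

declare S_one [simp] S_zero [simp] S_add [simp] S_diff [simp]
  S_minus [simp] S_scaleR [simp] S_mult [simp] S_C [simp] S_adj [simp]

lemma S_limit:
  assumes "\<And>n. f n \<in> S" "f \<longlonglongrightarrow> x"
  shows "x \<in> S"
proof (rule S_I)
  show "x \<in> C"
    using closed_sequentially[OF closed_C, of f x] assms by auto
  have "(\<lambda>n. adj (f n)) \<longlonglongrightarrow> adj x"
    by (rule tendsto_adj[OF assms(2)])
  then have "f \<longlonglongrightarrow> adj x"
    using assms(1) by simp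
  then show "adj x = x"
    using assms(2) by (rule LIMSEQ_unique)
qed

text \<open>The limit \<open>y\<close> of the iteration \<open>y \<mapsto> (z + y\<^sup>2) / 2\<close> started at \<open>0\<close> satisfies
  \<open>(1 - y)\<^sup>2 = 1 - z\<close>. The increments are dominated by those of the same iteration for the
  number \<open>z = 1\<close>, so that the boundary case \<open>\<parallel>z\<parallel> = 1\<close> is included.\<close>

lemma sqrt_one_minus:
  assumes z: "z \<in> S" "norm z \<le> 1"
  obtains y where "y \<in> S" "norm y \<le> 1" "(1 - y) * (1 - y) = 1 - z"
proof -
  define Y where "Y n = ((\<lambda>y. (1/2) *\<^sub>R (z + y * y)) ^^ n) 0" for n :: nat
  define t where "t n = ((\<lambda>y::real. (1/2) * (1 + y * y)) ^^ n) 0" for n :: nat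
  have Y_Suc: "Y (Suc n) = (1/2) *\<^sub>R (z + Y n * Y n)" for n by (simp add: Y_def)
  have t_Suc: "t (Suc n) = (1/2) * (1 + t n * t n)" for n by (simp add: t_def)
  have Y0: "Y 0 = 0" and t0: "t 0 = 0" by (simp_all add: Y_def t_def)
  have YS: "Y n \<in> S" for n
    by (induction n) (auto simp: Y0 Y_Suc z)
  have t: "0 \<le> t n \<and> t n \<le> 1" for n
  proof (induction n)
    case (Suc n)
    then have "t n * t n \<le> 1 * 1" by (intro mult_mono) auto
    then show ?case using Suc by (simp add: t_Suc)
  qed (simp add: t0)
  have Yt: "norm (Y n) \<le> t n" for n
  proof (induction n)
    case (Suc n)
    have "norm (z + Y n * Y n) \<le> 1 + t n * t n"
      using norm_triangle_ineq[of z "Y n * Y n"] norm_mult_ineq[of "Y n" "Y n"]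
        mult_mono[OF Suc Suc] z t[of n] by simp
    then show ?case by (simp add: Y_Suc t_Suc)
  qed (simp add: Y0 t0)
  have inc: "norm (Y (Suc n) - Y n) \<le> t (Suc n) - t n" for n
  proof (induction n)
    case 0
    show ?case using z by (simp add: Y_Suc t_Suc Y0 t0)
  next
    case (Suc n)
    have "Y (Suc (Suc n)) - Y (Suc n) = (1/2) *\<^sub>R (Y (Suc n) * Y (Suc n) - Y n * Y n)"
      by (subst (1 2) Y_Suc) (simp add: algebra_simps)
    also have "Y (Suc n) * Y (Suc n) - Y n * Y n = (Y (Suc n) + Y n) * (Y (Suc n) - Y n)"
      using commute[of "Y n" "Y (Suc n)"] YS by (simp add: algebra_simps)
    finally have "norm (Y (Suc (Suc n)) - Y (Suc n))
        \<le> (1/2) * (norm (Y (Suc n) + Y n) * norm (Y (Suc n) - Y n))"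
      using norm_mult_ineq[of "Y (Suc n) + Y n" "Y (Suc n) - Y n"] by simp
    also have "\<dots> \<le> (1/2) * ((t (Suc n) + t n) * (t (Suc n) - t n))"
    proof (intro mult_left_mono mult_mono Suc.IH)
      show "norm (Y (Suc n) + Y n) \<le> t (Suc n) + t n"
        using norm_triangle_ineq[of "Y (Suc n)" "Y n"] Yt[of n] Yt[of "Suc n"] by linarith
    qed (use t in \<open>auto intro: add_nonneg_nonneg\<close>)
    also have "\<dots> = t (Suc (Suc n)) - t (Suc n)"
      by (simp add: t_Suc[of "Suc n"] t_Suc[of n] algebra_simps)
    finally show ?case .
  qed
  \<comment> \<open>Monotonicity of \<open>t\<close> comes for free: by \<open>inc\<close> its
    increments bound norms and are therefore nonnegative.\<close>
  have "incseq t"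
    using order_trans[OF norm_ge_zero inc] by (intro incseq_SucI) simp
  then obtain l where "t \<longlonglongrightarrow> l"
    using incseq_convergent[of t 1] t by metis
  then have "summable (\<lambda>n. t (Suc n) - t n)"
    by (rule telescope_summable)
  then have "summable (\<lambda>n. Y (Suc n) - Y n)"
    by (rule summable_comparison_test[rotated]) (use inc in auto)
  then have "(\<lambda>n. \<Sum>i<n. Y (Suc i) - Y i) \<longlonglongrightarrow> (\<Sum>n. Y (Suc n) - Y n)"
    by (rule summable_LIMSEQ)
  moreover have "(\<Sum>i<n. Y (Suc i) - Y i) = Y n" for n
    by (induction n) (simp_all add: Y0)
  ultimately obtain y where y: "Y \<longlonglongrightarrow> y"
    by auto
  have "(\<lambda>n. Y (Suc n)) \<longlonglongrightarrow> y"
    using y by (rule LIMSEQ_Suc)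
  moreover have "(\<lambda>n. Y (Suc n)) \<longlonglongrightarrow> (1/2) *\<^sub>R (z + y * y)"
    unfolding Y_Suc by (intro tendsto_intros y)
  ultimately have "y = (1/2) *\<^sub>R (z + y * y)"
    by (rule LIMSEQ_unique)
  then have "2 *\<^sub>R y = 2 *\<^sub>R (1/2) *\<^sub>R (z + y * y)"
    by (rule arg_cong)
  then have "y + y = z + y * y"
    by (simp add: scaleR_2)
  then have "(1 - y) * (1 - y) = 1 - z"
    by (simp add: algebra_simps)
  moreover have "y \<in> S"
    using S_limit[OF YS y] .
  moreover have "norm y \<le> 1"
    by (rule Lim_bounded[OF tendsto_norm[OF y], of 0]) (use order_trans[OF Yt] t in blast)
  ultimately show ?thesis using that by blast
qed

text \<open>The mixed terms cancel because \<open>h\<close> and \<open>k\<close> commute. This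
  reduces positivity of \<open>adj b * b\<close> to selfadjoint squares.\<close>

lemma adj_mult_self:
  assumes h: "h \<in> S" and k: "k \<in> S"
  shows "adj (h + \<i> *\<^sub>C k) * (h + \<i> *\<^sub>C k) = h * h + k * k"
proof -
  have "adj (h + \<i> *\<^sub>C k) = h - \<i> *\<^sub>C k"
    using h k by (simp add: adj_add adj_scaleC scaleC_minus_left)
  moreover have "(h - \<i> *\<^sub>C k) * (h + \<i> *\<^sub>C k)
      = h * h + \<i> *\<^sub>C (h * k) - \<i> *\<^sub>C (k * h) - \<i> *\<^sub>C \<i> *\<^sub>C (k * k)"
    by (simp only: left_diff_distrib distrib_left mult_scaleC_left mult_scaleC_right scaleC_diff_right diff_diff_eq add_diff_eq)
       (simp add: algebra_simps)
  moreover have "h * k = k * h"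
    using h k by (intro commute) auto
  ultimately show ?thesis
    by (simp add: scaleC_scaleC scaleC_minus_left)
qed

text \<open>The triangle inequality alone gives only the bound 2. With \<open>k\<close> a square
  root of \<open>1 - h * h\<close>, the element \<open>u = h + \<i> *\<^sub>C k\<close> satisfies
  \<open>adj u * u = 1\<close>, so its imaginary part \<open>k\<close> has norm at most one, and
  \<open>k * k\<close> is the element in question.\<close>

lemma norm_one_minus_square:
  assumes h: "h \<in> S" "norm h \<le> 1"
  shows "norm (1 - h * h) \<le> 1"
proof -
  have "norm (h * h) \<le> 1"
    using norm_mult_ineq[of h h] mult_mono[of "norm h" 1 "norm h" 1] h by simp
  then obtain y where y: "y \<in> S" "(1 - y) * (1 - y) = 1 - h * h"
    using sqrt_one_minus[of "h * h"] h by auto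
  define k where "k = 1 - y"
  have k: "k \<in> S" "k * k = 1 - h * h"
    using y by (auto simp: k_def)
  define u where "u = h + \<i> *\<^sub>C k"
  have "adj u * u = h * h + k * k"
    unfolding u_def using h(1) k(1) by (rule adj_mult_self)
  then have "(norm u)\<^sup>2 \<le> 1"
    using cstar_identity[of u] norm_one_le[where 'a='a] k by simp
  then have u: "norm u \<le> 1"
    by (simp add: power_le_one_iff)
  have "u - adj u = (2 * \<i>) *\<^sub>C k"
    using h k(1) by (simp add: u_def adj_add adj_scaleC scaleC_minus_left flip: scaleC_add_left)
  then have "2 * norm k = norm (u - adj u)"
    by (simp add: norm_scaleC norm_mult)
  also have "\<dots> \<le> 2"
    using norm_triangle_ineq4[of u "adj u"] u by simp
  finally have "norm (k * k) \<le> 1"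
    using norm_mult_ineq[of k k] mult_mono[of "norm k" 1 "norm k" 1] by simp
  then show ?thesis
    by (simp add: k)
qed

lemma norm_diff_square:
  assumes h: "h \<in> S" "norm h \<le> r"
  shows "norm (r\<^sup>2 *\<^sub>R 1 - h * h) \<le> r\<^sup>2"
proof (cases "r = 0")
  case False
  then have r: "r > 0" using h norm_ge_zero[of h] by linarith
  define g where "g = (1/r) *\<^sub>R h"
  have "g \<in> S" "norm g \<le> 1" "h = r *\<^sub>R g"
    using h r by (auto simp: g_def)
  then have "norm (1 - g * g) \<le> 1"
    by (intro norm_one_minus_square)
  then have "r\<^sup>2 * norm (1 - g * g) \<le> r\<^sup>2 * 1"
    by (intro mult_left_mono) auto
  moreover have "r\<^sup>2 *\<^sub>R 1 - h * h = r\<^sup>2 *\<^sub>R (1 - g * g)"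
    using \<open>h = r *\<^sub>R g\<close> by (simp add: algebra_simps power2_eq_square)
  ultimately show ?thesis by simp
next
  case True
  then have "h = 0" using h(2) by simp
  then show ?thesis using True by simp
qed

text \<open>Scaling reduces this to a root of \<open>1 - z\<close> with
  \<open>z = 1 - (1/t) *\<^sub>R x\<close>. The bound on \<open>y\<close> supplied there becomes the
  last conclusion, which makes the root itself positive and not merely selfadjoint.\<close>

lemma sqrt_exists:
  assumes x: "x \<in> S" "t \<ge> 0" "norm (t *\<^sub>R 1 - x) \<le> t"
  obtains s where "s \<in> S" "s * s = x" "norm (sqrt t *\<^sub>R 1 - s) \<le> sqrt t"
proof (cases "t = 0")
  case True
  then show ?thesis using that[of 0] x by auto
next
  case False
  with x have t: "t > 0" by simp
  have z: "1 - (1/t) *\<^sub>R x = (1/t) *\<^sub>R (t *\<^sub>R 1 - x)"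
    using t by (simp add: algebra_simps)
  have "norm (1 - (1/t) *\<^sub>R x) \<le> 1"
    unfolding z using x t by simp
  then obtain y where y: "y \<in> S" "norm y \<le> 1" "(1 - y) * (1 - y) = 1 - (1 - (1/t) *\<^sub>R x)"
    using sqrt_one_minus[of "1 - (1/t) *\<^sub>R x"] x by auto
  show ?thesis
  proof (rule that[of "sqrt t *\<^sub>R (1 - y)"])
    show "sqrt t *\<^sub>R (1 - y) * sqrt t *\<^sub>R (1 - y) = x"
      using y t by simp
    have "sqrt t *\<^sub>R 1 - sqrt t *\<^sub>R (1 - y) = sqrt t *\<^sub>R y"
      by (simp add: algebra_simps)
    then show "norm (sqrt t *\<^sub>R 1 - sqrt t *\<^sub>R (1 - y)) \<le> sqrt t"
      using y t by simp
  qed (use y in auto)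
qed

lemma real_imaginary_parts:
  assumes "b \<in> C"
  obtains h k where "h \<in> S" "k \<in> S" "b = h + \<i> *\<^sub>C k"
proof
  show "(1/2) *\<^sub>R (b + adj b) \<in> S"
    using assms by (intro S_I) (auto simp: adj_scaleR adj_add adj_adj algebra_simps)
  show "(1/2) *\<^sub>R ((-\<i>) *\<^sub>C (b - adj b)) \<in> S"
    using assms by (intro S_I) (auto simp: adj_scaleR adj_add adj_diff adj_adj adj_scaleC
        scaleC_minus_left algebra_simps scaleC_add_right scaleC_minus_right simp flip: scaleC_minus_right)
  have "\<i> *\<^sub>C (1/2) *\<^sub>R ((-\<i>) *\<^sub>C (b - adj b)) = (1/2) *\<^sub>R (b - adj b)"
    by (simp add: scaleR_scaleC scaleC_scaleC)
  then show "b = (1/2) *\<^sub>R (b + adj b) + \<i> *\<^sub>C (1/2) *\<^sub>R ((-\<i>) *\<^sub>C (b - adj b))"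
    by (simp flip: scaleR_add_right)
qed

section \<open>The cone of positive elements described by norms\<close>

lemma square_P: "h \<in> S \<Longrightarrow> h * h \<in> P"
  by (auto simp: positive_cone_def intro!: exI[of _ h])

text \<open>This is why positivity is tested by balls of radius \<open>t\<close> about
  \<open>t\<close>: closure under sums, invisible from the form \<open>adj b * b\<close>, becomes
  the triangle inequality.\<close>

lemma norm_ball_add:
  assumes "norm (t *\<^sub>R 1 - x) \<le> t" "norm (u *\<^sub>R 1 - y) \<le> u"
  shows "norm ((t + u) *\<^sub>R 1 - (x + y::'a)) \<le> t + u"
proof -
  have "(t + u) *\<^sub>R 1 - (x + y) = (t *\<^sub>R 1 - x) + (u *\<^sub>R 1 - y)"
    by (simp add: algebra_simps)
  then show ?thesis
    using order_trans[OF norm_triangle_ineq add_mono[OF assms]] by (simp only:)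
qed

text \<open>Splitting \<open>b\<close> into real and imaginary parts makes \<open>adj b * b\<close>
  a sum of two squares, each in a ball with the squared norm as radius. Conversely, the ball
  condition supplies a square root.\<close>

lemma P_norm: "x \<in> P \<longleftrightarrow> x \<in> S \<and> (\<exists>t\<ge>0. norm (t *\<^sub>R 1 - x) \<le> t)"
proof
  assume "x \<in> P"
  then obtain b where b: "b \<in> C" "x = adj b * b"
    by (auto simp: positive_cone_def)
  then obtain h k where hk: "h \<in> S" "k \<in> S" "b = h + \<i> *\<^sub>C k"
    using real_imaginary_parts by blast
  then have x: "x = h * h + k * k"
    using b adj_mult_self by simp
  have "norm (((norm h)\<^sup>2 + (norm k)\<^sup>2) *\<^sub>R 1 - x) \<le> (norm h)\<^sup>2 + (norm k)\<^sup>2"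
    unfolding x by (intro norm_ball_add norm_diff_square hk order_refl)
  then show "x \<in> S \<and> (\<exists>t\<ge>0. norm (t *\<^sub>R 1 - x) \<le> t)"
    using x hk by (auto intro!: exI[of _ "(norm h)\<^sup>2 + (norm k)\<^sup>2"])
next
  assume "x \<in> S \<and> (\<exists>t\<ge>0. norm (t *\<^sub>R 1 - x) \<le> t)"
  then show "x \<in> P"
    using sqrt_exists square_P by metis
qed

lemma P_S [simp]: "x \<in> P \<Longrightarrow> x \<in> S"
  by (simp add: P_norm)

lemma P_C [simp]: "x \<in> P \<Longrightarrow> x \<in> C"
  by simp

lemma P_sqrt:
  assumes "x \<in> P"
  obtains s where "s \<in> P" "s * s = x"
proof -
  obtain t where t: "x \<in> S" "t \<ge> 0" "norm (t *\<^sub>R 1 - x) \<le> t"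
    using assms P_norm by auto
  obtain s where s: "s \<in> S" "s * s = x" "norm (sqrt t *\<^sub>R 1 - s) \<le> sqrt t"
    using sqrt_exists[OF t] .
  have "s \<in> P"
    unfolding P_norm using s t(2) by (auto intro: exI[of _ "sqrt t"])
  with s show ?thesis using that by blast
qed

lemma P_add [simp]:
  assumes "x \<in> P" "y \<in> P" shows "x + y \<in> P"
proof -
  obtain t u where "t \<ge> 0" "norm (t *\<^sub>R 1 - x) \<le> t" "u \<ge> 0" "norm (u *\<^sub>R 1 - y) \<le> u"
    using assms P_norm by metis
  then have "t + u \<ge> 0 \<and> norm ((t + u) *\<^sub>R 1 - (x + y)) \<le> t + u"
    using norm_ball_add by simp
  moreover have "x + y \<in> S"
    using assms by simp
  ultimately show ?thesis
    unfolding P_norm by blast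
qed

lemma P_zero [simp]: "0 \<in> P"
  using square_P[of 0] by simp

lemma P_one [simp]: "1 \<in> P"
  using square_P[of 1] by simp

lemma P_scaleR [simp]:
  assumes "x \<in> P" "r \<ge> 0" shows "r *\<^sub>R x \<in> P"
proof -
  obtain s where "s \<in> P" "s * s = x" using P_sqrt assms by blast
  then show ?thesis
    using square_P[of "sqrt r *\<^sub>R s"] assms by auto
qed

lemma P_mult [simp]:
  assumes "x \<in> P" "y \<in> P" shows "x * y \<in> P"
proof -
  obtain s u where "s \<in> P" "s * s = x" "u \<in> P" "u * u = y" using P_sqrt assms by metis
  then have "x * y = (s * u) * (s * u)"
    by (simp add: mult.assoc left_commute flip: \<open>s * s = x\<close> \<open>u * u = y\<close>)
  then show ?thesis
    using square_P[of "s * u"] \<open>s \<in> P\<close> \<open>u \<in> P\<close> by auto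
qed

text \<open>In \<open>P_norm\<close> the radius is merely some number; here every bound of the norm
  is admissible, which allows one radius for a whole family of elements. The reason is that a
  selfadjoint root \<open>s\<close> has \<open>(norm s)\<^sup>2 = norm x\<close>.\<close>

lemma P_norm_bound:
  assumes x: "x \<in> P" "norm x \<le> t"
  shows "norm (t *\<^sub>R 1 - x) \<le> t"
proof -
  obtain s where s: "s \<in> P" "s * s = x" using P_sqrt assms by blast
  have "(norm s)\<^sup>2 = norm x"
    using s cstar_identity[of s] by simp
  then have "norm s \<le> sqrt t"
    using x real_le_rsqrt by simp
  moreover have "t \<ge> 0"
    using x norm_ge_zero order_trans by blast
  ultimately show ?thesis
    using norm_diff_square[of s "sqrt t"] s by auto
qed

lemma norm_minus_P: "x \<in> S \<Longrightarrow> norm x \<le> t \<Longrightarrow> t *\<^sub>R 1 - x \<in> P"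
  unfolding P_norm by (auto intro!: exI[of _ t] intro: order_trans[OF norm_ge_zero])

text \<open>The single radius \<open>norm x + 1\<close> serves all \<open>x + e *\<^sub>R 1\<close>
  with \<open>e < 1\<close>, so the norm inequality passes to the limit.\<close>

lemma P_closed:
  assumes "x \<in> S" "\<And>e. e > 0 \<Longrightarrow> x + e *\<^sub>R 1 \<in> P"
  shows "x \<in> P"
proof -
  define t where "t = norm x + 1"
  have le: "norm (t *\<^sub>R 1 - (x + e *\<^sub>R 1)) \<le> t" if e: "e > 0" "e < 1" for e
  proof (rule P_norm_bound)
    have "norm (e *\<^sub>R (1::'a)) \<le> 1"
      using mult_mono[of e 1 "norm (1::'a)" 1] norm_one_le[where 'a='a] e by simp
    then show "norm (x + e *\<^sub>R 1) \<le> t"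
      unfolding t_def using norm_triangle_ineq[of x "e *\<^sub>R 1"] by linarith
  qed (use assms e in auto)
  have "((\<lambda>e. norm (t *\<^sub>R 1 - (x + e *\<^sub>R 1))) \<longlongrightarrow> norm (t *\<^sub>R 1 - (x + 0 *\<^sub>R 1))) (at_right 0)"
    by (intro tendsto_intros)
  moreover have "\<forall>\<^sub>F e in at_right 0. norm (t *\<^sub>R 1 - (x + e *\<^sub>R 1)) \<le> t"
    unfolding eventually_at_right_field by (rule exI[of _ 1]) (use le in auto)
  ultimately have "norm (t *\<^sub>R 1 - x) \<le> t"
    using tendsto_upperbound[of _ _ "at_right (0::real)"] by fastforce
  then show ?thesis
    unfolding P_norm using assms(1) by (auto intro!: exI[of _ t] simp: t_def)
qed

text \<open>With \<open>t = norm x\<close>, both \<open>t - x\<close> and \<open>t + x\<close> have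
  norm at most \<open>t\<close>. The difference of their squares is \<open>4 t x\<close>, of norm
  \<open>4 t^2\<close>, yet its norm is at most \<open>2 t^2\<close>.\<close>

lemma P_antisym:
  assumes "x \<in> P" "- x \<in> P"
  shows "x = 0"
proof (rule ccontr)
  assume "x \<noteq> 0"
  define t where "t = norm x"
  have t: "t > 0" using \<open>x \<noteq> 0\<close> by (simp add: t_def)
  have 1: "norm (t *\<^sub>R 1 - x) \<le> t" "norm (t *\<^sub>R 1 + x) \<le> t"
    using P_norm_bound[OF assms(1), of t] P_norm_bound[OF assms(2), of t] by (auto simp: t_def)
  have "(4 * t) *\<^sub>R x = (t *\<^sub>R 1 + x) * (t *\<^sub>R 1 + x) - (t *\<^sub>R 1 - x) * (t *\<^sub>R 1 - x)"
    by (simp add: algebra_simps flip: scaleR_add_left)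
  also have "norm \<dots> \<le> t * t + t * t"
    by (intro order_trans[OF norm_triangle_ineq4] add_mono order_trans[OF norm_mult_ineq] mult_mono 1)
       (use t in auto)
  finally show False
    using mult_pos_pos[OF t t] by (simp add: t_def)
qed

lemma S_eq_diff_P:
  assumes "x \<in> S"
  obtains p q where "p \<in> P" "q \<in> P" "x = p - q"
proof
  show "norm x *\<^sub>R 1 \<in> P" by auto
  show "norm x *\<^sub>R 1 - x \<in> P" using assms by (rule norm_minus_P) simp
qed simp

subsection \<open>Existence of characters\<close>

text \<open>If \<open>a + r \<ge> 0\<close> with \<open>r \<ge> 0\<close> and \<open>k \<ge> q\<close>, then \<open>k\<^sup>2 (a + r) - k\<close> is a sum of products of positive elements, so
  that \<open>r\<close> can be lowered repeatedly by \<open>1 / k\<close>.\<close>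

lemma P_if_mult_ge_one:
  assumes a: "a \<in> S" and p: "p \<in> P" and q: "q \<in> P" and aq: "a * q = 1 + p"
  shows "a \<in> P"
proof -
  define k where "k = norm q + 1"
  have k: "k > 0" by (simp add: k_def add_nonneg_pos)
  define w where "w = k *\<^sub>R 1 - q"
  have w: "w \<in> P"
    unfolding w_def by (rule norm_minus_P) (use q in \<open>auto simp: k_def\<close>)
  have step: "a + (r - 1/k) *\<^sub>R 1 \<in> P" if r: "r \<ge> 0" "a + r *\<^sub>R 1 \<in> P" for r
  proof -
    define b where "b = a + r *\<^sub>R 1"
    \<comment> \<open>Since \<open>k *\<^sub>R 1 - w = q\<close>, the difference of squares brings
      in the factor \<open>q\<close>, and \<open>q * b\<close> is known from \<open>aq\<close>. Its
      summand 1 contributes the constant \<open>k\<close> that is moved to the left.\<close>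
    have "k\<^sup>2 *\<^sub>R b - w * w * b = (k *\<^sub>R 1 + w) * (k *\<^sub>R 1 - w) * b"
      by (simp add: algebra_simps power2_eq_square)
    also have "\<dots> = (k *\<^sub>R 1 + w) * (q * b)"
      by (simp add: w_def mult.assoc)
    also have "q * b = 1 + p + r *\<^sub>R q"
      using commute[of q a] a q aq by (simp add: b_def distrib_left)
    finally have "k\<^sup>2 *\<^sub>R b - k *\<^sub>R 1 = w * w * b + w + (k *\<^sub>R 1 + w) * p + (k *\<^sub>R 1 + w) * (r *\<^sub>R q)"
      by (simp add: algebra_simps)
    also have "\<dots> \<in> P"
      using w p q k r by (intro P_add P_mult P_scaleR P_one) (auto simp: b_def)
    finally have "(1/k\<^sup>2) *\<^sub>R (k\<^sup>2 *\<^sub>R b - k *\<^sub>R 1) \<in> P"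
      by (rule P_scaleR) simp
    also have "(1/k\<^sup>2) *\<^sub>R (k\<^sup>2 *\<^sub>R b - k *\<^sub>R 1) = a + (r - 1/k) *\<^sub>R 1"
      using k by (simp add: b_def algebra_simps power2_eq_square)
    finally show ?thesis .
  qed
  \<comment> \<open>The shift descends from \<open>norm a\<close> in steps of \<open>1 / k\<close>,
    and \<open>step\<close> needs it to be nonnegative. The first disjunct absorbs the remaining
    case: a membership with negative shift already puts \<open>a\<close> into the cone.\<close>
  have "a \<in> P \<or> a + (norm a - real m / k) *\<^sub>R 1 \<in> P" for m
  proof (induction m)
    case 0
    have "norm a *\<^sub>R 1 - (- a) \<in> P"
      by (rule norm_minus_P) (use a in auto)
    then show ?case by (simp add: add.commute)
  next
    case (Suc m)
    define r where "r = norm a - real m / k"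
    show ?case
    proof (cases "a \<in> P")
      case False
      then have mem: "a + r *\<^sub>R 1 \<in> P"
        using Suc by (simp add: r_def)
      have "r \<ge> 0"
      proof (rule ccontr)
        assume "\<not> r \<ge> 0"
        then have "(a + r *\<^sub>R 1) + (- r) *\<^sub>R 1 \<in> P"
          using mem by (intro P_add[OF mem] P_scaleR) auto
        with False show False by simp
      qed
      from step[OF this mem] show ?thesis
        by (simp add: r_def add_divide_distrib algebra_simps)
    qed simp
  qed
  moreover obtain m :: nat where "norm a * k < real m"
    using reals_Archimedean2 by blast
  then have "real m / k - norm a \<ge> 0"
    using k by (simp add: field_simps)
  ultimately have "a \<in> P \<or> (a + (norm a - real m / k) *\<^sub>R 1) + (real m / k - norm a) *\<^sub>R 1 \<in> P"
    using P_add P_scaleR[OF P_one] by blast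
  then show ?thesis
    by (simp add: algebra_simps)
qed

text \<open>The quadratic modules of real algebra, with the cone in place of the sums of squares.
  Closure under products is not demanded, so that adjoining \<open>x\<close> produces just the
  linear expressions \<open>m + p * x\<close>.\<close>

definition P_module :: "'a set \<Rightarrow> bool" where
  "P_module Q \<longleftrightarrow> P \<subseteq> Q \<and> Q \<subseteq> S \<and> (\<forall>x\<in>Q. \<forall>y\<in>Q. x + y \<in> Q) \<and> (\<forall>p\<in>P. \<forall>x\<in>Q. p * x \<in> Q)"

lemma P_module_adjoin:
  assumes Q: "P_module Q" and x: "x \<in> S"
  shows "P_module {m + p * x | m p. m \<in> Q \<and> p \<in> P}" (is "P_module ?R")
    and "Q \<subseteq> {m + p * x | m p. m \<in> Q \<and> p \<in> P}"
    and "x \<in> {m + p * x | m p. m \<in> Q \<and> p \<in> P}"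
proof -
  have "0 \<in> Q" using Q by (auto simp: P_module_def)
  show sub: "Q \<subseteq> ?R"
  proof
    fix m assume "m \<in> Q"
    moreover have "m = m + 0 * x" by simp
    ultimately show "m \<in> ?R" using P_zero by blast
  qed
  show "x \<in> ?R"
  proof -
    have "x = 0 + 1 * x" by simp
    then show ?thesis using \<open>0 \<in> Q\<close> P_one by blast
  qed
  show "P_module ?R"
    unfolding P_module_def
  proof (intro conjI ballI)
    show "P \<subseteq> ?R" using sub Q by (auto simp: P_module_def)
    show "?R \<subseteq> S" using Q x by (auto simp: P_module_def)
  next
    fix u v assume "u \<in> ?R" "v \<in> ?R"
    then obtain m p m' p' where *: "m \<in> Q" "p \<in> P" "u = m + p * x" "m' \<in> Q" "p' \<in> P" "v = m' + p' * x"
      by auto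
    then have "u + v = (m + m') + (p + p') * x"
      by (simp add: algebra_simps)
    moreover have "m + m' \<in> Q" "p + p' \<in> P"
      using * Q by (auto simp: P_module_def)
    ultimately show "u + v \<in> ?R" by blast
  next
    fix r u assume "r \<in> P" "u \<in> ?R"
    then obtain m p where *: "m \<in> Q" "p \<in> P" "u = m + p * x"
      by auto
    then have "r * u = r * m + (r * p) * x"
      by (simp add: algebra_simps)
    moreover have "r * m \<in> Q" "r * p \<in> P"
      using * Q \<open>r \<in> P\<close> by (auto simp: P_module_def)
    ultimately show "r * u \<in> ?R" by blast
  qed
qed

lemma P_module_maximal:
  assumes "P_module Q" "- 1 \<notin> Q"
  obtains M where "P_module M" "Q \<subseteq> M" "- 1 \<notin> M" "\<And>N. P_module N \<Longrightarrow> - 1 \<notin> N \<Longrightarrow> M \<subseteq> N \<Longrightarrow> N = M"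
proof -
  let ?A = "{M. P_module M \<and> Q \<subseteq> M \<and> - 1 \<notin> M}"
  have "\<exists>M\<in>?A. \<forall>X\<in>?A. M \<subseteq> X \<longrightarrow> X = M"
  proof (rule subset_Zorn_nonempty)
    show "?A \<noteq> {}" using assms by auto
  next
    fix \<C> assume ne: "\<C> \<noteq> {}" and ch: "subset.chain ?A \<C>"
    have A: "P_module M" "Q \<subseteq> M" "- 1 \<notin> M" if "M \<in> \<C>" for M
      using ch that by (auto simp: subset_chain_def)
    have "x + y \<in> \<Union>\<C>" if xy: "x \<in> \<Union>\<C>" "y \<in> \<Union>\<C>" for x y
    proof -
      obtain M N where *: "M \<in> \<C>" "x \<in> M" "N \<in> \<C>" "y \<in> N" using xy by blast
      then have "M \<subseteq> N \<or> N \<subseteq> M" using ch by (auto simp: subset_chain_def)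
      then have "\<exists>K\<in>\<C>. x \<in> K \<and> y \<in> K" using * by blast
      then show ?thesis using A(1) by (auto simp: P_module_def)
    qed
    moreover have "P \<subseteq> \<Union>\<C>" "Q \<subseteq> \<Union>\<C>" "\<Union>\<C> \<subseteq> S"
    proof -
      obtain M\<^sub>0 where "M\<^sub>0 \<in> \<C>" using ne by blast
      then show "P \<subseteq> \<Union>\<C>" "Q \<subseteq> \<Union>\<C>"
        using A(1,2)[of M\<^sub>0] unfolding P_module_def by blast+
      show "\<Union>\<C> \<subseteq> S"
        using A(1) unfolding P_module_def by blast
    qed
    moreover have "p * x \<in> \<Union>\<C>" if "p \<in> P" "x \<in> \<Union>\<C>" for p x
    proof -
      obtain M where "M \<in> \<C>" "x \<in> M" using \<open>x \<in> \<Union>\<C>\<close> by blast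
      then have "p * x \<in> M"
        using A(1)[of M] \<open>p \<in> P\<close> unfolding P_module_def by metis
      with \<open>M \<in> \<C>\<close> show ?thesis by (rule UnionI)
    qed
    ultimately show "\<Union>\<C> \<in> ?A"
      using A(3) unfolding P_module_def mem_Collect_eq by (intro conjI ballI notI) (assumption | auto)+
  qed
  then obtain M where M: "M \<in> ?A" "\<forall>X\<in>?A. M \<subseteq> X \<longrightarrow> X = M"
    by (elim bexE)
  show ?thesis
  proof (rule that[of M])
    show "N = M" if "P_module N" "- 1 \<notin> N" "M \<subseteq> N" for N
    proof -
      have "N \<in> ?A" using M(1) that by auto
      from bspec[OF M(2) this] that(3) show ?thesis by (rule mp)
    qed
  qed (use M in simp_all)
qed

text \<open>If neither \<open>x\<close> nor \<open>- x\<close> belongs to the maximal module \<open>M\<close>, then \<open>- 1\<close> is of both forms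
  \<open>m + p x\<close> and \<open>m' - p' x\<close>; multiplying crosswise puts \<open>p\<close> into the ideal \<open>M \<inter> - M\<close>.\<close>

lemma P_module_maximal_total:
  assumes M: "P_module M" "- 1 \<notin> M" "\<And>N. P_module N \<Longrightarrow> - 1 \<notin> N \<Longrightarrow> M \<subseteq> N \<Longrightarrow> N = M"
    and x: "x \<in> S"
  shows "x \<in> M \<or> - x \<in> M"
proof (rule ccontr)
  assume nx: "\<not> ?thesis"
  have add: "u \<in> M \<Longrightarrow> v \<in> M \<Longrightarrow> u + v \<in> M" and mult: "r \<in> P \<Longrightarrow> u \<in> M \<Longrightarrow> r * u \<in> M"
    and PM: "u \<in> P \<Longrightarrow> u \<in> M" and MS: "u \<in> M \<Longrightarrow> u \<in> S" for r u v
    using M(1) by (auto simp: P_module_def)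
  have ext: "\<exists>m p. m \<in> M \<and> p \<in> P \<and> - 1 = m + p * y" if "y \<in> S" "y \<notin> M" for y
    using P_module_adjoin[OF M(1) \<open>y \<in> S\<close>] M(3) that by blast
  obtain m p where m: "m \<in> M" "p \<in> P" "- 1 = m + p * x"
    using ext[of x] x nx by blast
  obtain m' p' where m': "m' \<in> M" "p' \<in> P" "- 1 = m' + p' * (- x)"
    using ext[OF S_minus[OF x]] nx by blast
  have eqs: "- p' = p' * (m + p * x)" "- p = p * (m' + p' * (- x))"
    using m(3) m'(3) by (metis mult_minus_right mult_1_right)+
  have "p * (p' * x) = p * m' + p"
    using arg_cong[OF eqs(2), of uminus] by (simp add: right_diff_distrib eq_diff_eq add.commute)
  moreover have "p' * (p * x) = - p' - p' * m"
    unfolding eqs(1) by (simp add: distrib_left)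
  moreover have "p * (p' * x) = p' * (p * x)"
    using m(2) m'(2) by (intro left_commute) auto
  ultimately have "p * m' + p = - p' - p' * m"
    by simp
  then have "(p * m' + p) + (p' + p' * m) = (- p' - p' * m) + (p' + p' * m)"
    by (rule arg_cong)
  then have "p + (p' + p' * m + p * m') = 0"
    by (simp add: algebra_simps)
  then have "- p = p' + p' * m + p * m'"
    by (rule minus_unique)
  then have mp: "- p \<in> M"
    using add[OF add[OF PM[OF m'(2)] mult[OF m'(2) m(1)]] mult[OF m(2) m'(1)]] by simp
  \<comment> \<open>Only multiplication by elements of the cone preserves \<open>M\<close>.
    Splitting \<open>x\<close> gives \<open>p * x = u * p + v * (- p)\<close>, and both
    \<open>p\<close> and \<open>- p\<close> belong to \<open>M\<close>.\<close>
  obtain u v where uv: "u \<in> P" "v \<in> P" "x = u - v"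
    using S_eq_diff_P[OF x] .
  have "u * p + v * (- p) \<in> M"
    using uv mp PM m by (intro add mult) auto
  moreover have "u * p + v * (- p) = p * x"
    unfolding uv(3) using commute[of p u] commute[of p v] uv(1,2) m(2) by (simp add: right_diff_distrib)
  ultimately have "m + p * x \<in> M"
    using add[OF m(1)] by simp
  then show False
    using m(3) M(2) by simp
qed

text \<open>A maximal module \<open>M\<close> containing \<open>- a\<close> is a total order up to infinitesimals \<open>J\<close>, and \<open>J\<close> is
  an ideal of codimension one; the required functional sends \<open>x\<close> to the number \<open>r\<close> with
  \<open>x - r \<in> J\<close>.\<close>

lemma real_character_exists:
  assumes a: "a \<in> S" "a \<notin> P"
  obtains f :: "'a \<Rightarrow> real" where "f 1 = 1" "f a \<le> 0"
    "\<And>x y. x \<in> S \<Longrightarrow> y \<in> S \<Longrightarrow> f (x + y) = f x + f y"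
    "\<And>x r. x \<in> S \<Longrightarrow> f (r *\<^sub>R x) = r * f x"
    "\<And>x y. x \<in> S \<Longrightarrow> y \<in> S \<Longrightarrow> f (x * y) = f x * f y"
proof -
  have "P_module P" by (auto simp: P_module_def)
  note adj = P_module_adjoin[OF this, of "- a"]
  let ?Q = "{m + p * (- a) | m p. m \<in> P \<and> p \<in> P}"
  have Q: "P_module ?Q" "- a \<in> ?Q"
    using adj a by auto
  \<comment> \<open>Here \<open>a \<notin> P\<close> enters: an expression of \<open>- 1\<close> in
    this form says that \<open>a * p = 1 + m\<close>.\<close>
  have "- 1 \<notin> ?Q"
  proof
    assume "- 1 \<in> ?Q"
    then obtain m p where "m \<in> P" "p \<in> P" "- 1 = m + p * (- a)" by blast
    then have "m \<in> P" "p \<in> P" "a * p = 1 + m"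
      using commute[of p a] a by (auto simp: algebra_simps)
    then show False using P_if_mult_ge_one a by blast
  qed
  then obtain M where M: "P_module M" "?Q \<subseteq> M" "- 1 \<notin> M"
      "\<And>N. P_module N \<Longrightarrow> - 1 \<notin> N \<Longrightarrow> M \<subseteq> N \<Longrightarrow> N = M"
    using P_module_maximal[OF Q(1)] by blast
  have add: "u \<in> M \<Longrightarrow> v \<in> M \<Longrightarrow> u + v \<in> M" and mult: "r \<in> P \<Longrightarrow> u \<in> M \<Longrightarrow> r * u \<in> M"
    and PM: "u \<in> P \<Longrightarrow> u \<in> M" and MS: "u \<in> M \<Longrightarrow> u \<in> S" for r u v
    using M(1) by (auto simp: P_module_def)
  have scale: "r *\<^sub>R u \<in> M" if "u \<in> M" "r \<ge> 0" for r u
    using mult[of "r *\<^sub>R 1" u] that by simp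
  have total: "x \<in> M \<or> - x \<in> M" if "x \<in> S" for x
    using P_module_maximal_total M that by blast
  have neg: "r *\<^sub>R 1 \<notin> M" if "r < 0" for r
    using scale[of "r *\<^sub>R 1" "- inverse r"] that M(3) by auto
  define J where "J = {x \<in> S. \<forall>e>0. e *\<^sub>R 1 + x \<in> M \<and> e *\<^sub>R 1 - x \<in> M}"
  have J: "x \<in> J \<Longrightarrow> x \<in> S" "x \<in> J \<Longrightarrow> e > 0 \<Longrightarrow> e *\<^sub>R 1 + x \<in> M" "x \<in> J \<Longrightarrow> e > 0 \<Longrightarrow> e *\<^sub>R 1 - x \<in> M"
    for x e by (simp_all add: J_def)
  have J0: "0 \<in> J" using PM by (auto simp: J_def)
  have J_uminus: "- x \<in> J" if "x \<in> J" for x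
    using that by (auto simp: J_def)
  have J_add: "x + y \<in> J" if "x \<in> J" "y \<in> J" for x y
  proof -
    have "e *\<^sub>R 1 + (x + y) \<in> M \<and> e *\<^sub>R 1 - (x + y) \<in> M" if "e > 0" for e
    proof -
      have "((e/2) *\<^sub>R 1 + x) + ((e/2) *\<^sub>R 1 + y) \<in> M" "((e/2) *\<^sub>R 1 - x) + ((e/2) *\<^sub>R 1 - y) \<in> M"
        using \<open>x \<in> J\<close> \<open>y \<in> J\<close> \<open>e > 0\<close> J by (simp_all add: add)
      moreover have "(e/2) *\<^sub>R (1::'a) + (e/2) *\<^sub>R 1 = e *\<^sub>R 1"
        by (simp flip: scaleR_add_left)
      ultimately show ?thesis
        by (simp add: algebra_simps)
    qed
    then show ?thesis using that by (auto simp: J_def)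
  qed
  have J_P: "p * x \<in> J" if "x \<in> J" "p \<in> P" for x p
  proof -
    define n where "n = norm p + 1"
    have n: "n > 0" by (simp add: n_def add_nonneg_pos)
    have np: "n *\<^sub>R 1 - p \<in> P"
      by (rule norm_minus_P) (use that in \<open>auto simp: n_def\<close>)
    have "e *\<^sub>R 1 + p * y \<in> M" if e: "e > 0" and y: "y \<in> J" for e y
    proof -
      \<comment> \<open>Multiplication by \<open>p\<close> turns the constant \<open>e/n\<close>
        into \<open>(e/n) *\<^sub>R p\<close>; the second summand, positive because \<open>n\<close>
        exceeds the norm of \<open>p\<close>, completes it to the constant \<open>e\<close>.\<close>
      have "p * ((e/n) *\<^sub>R 1 + y) + (e/n) *\<^sub>R (n *\<^sub>R 1 - p) \<in> M"
        using y e n np \<open>p \<in> P\<close> by (intro add mult scale PM J) auto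
      moreover have "p * ((e/n) *\<^sub>R 1 + y) + (e/n) *\<^sub>R (n *\<^sub>R 1 - p) = e *\<^sub>R 1 + p * y"
        using n by (simp add: algebra_simps)
      ultimately show ?thesis by simp
    qed
    from this[of _ x] this[of _ "- x"] show ?thesis
      using that J_uminus by (auto simp: J_def)
  qed
  have J_mult: "y * x \<in> J" if "x \<in> J" "y \<in> S" for x y
  proof -
    obtain u v where uv: "u \<in> P" "v \<in> P" "y = u - v"
      using S_eq_diff_P[OF \<open>y \<in> S\<close>] .
    have "u * x + v * (- x) \<in> J"
      using uv that by (intro J_add J_P J_uminus)
    then show ?thesis unfolding uv(3) by (simp add: left_diff_distrib)
  qed
  have J_const: "r = 0" if "r *\<^sub>R 1 \<in> J" for r
  proof (rule ccontr)
    assume "r \<noteq> 0"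
    then have "(\<bar>r\<bar>/2) *\<^sub>R 1 + r *\<^sub>R 1 \<in> M" "(\<bar>r\<bar>/2) *\<^sub>R 1 - r *\<^sub>R 1 \<in> M"
      using that by (auto intro!: J)
    then have "(\<bar>r\<bar>/2 + r) *\<^sub>R 1 \<in> M" "(\<bar>r\<bar>/2 - r) *\<^sub>R 1 \<in> M"
      by (simp_all only: scaleR_add_left scaleR_diff_left)
    then show False
      using neg[of "\<bar>r\<bar>/2 + r"] neg[of "\<bar>r\<bar>/2 - r"] \<open>r \<noteq> 0\<close> by (cases "r > 0") auto
  qed
  have ex: "\<exists>r. x - r *\<^sub>R 1 \<in> J" if x: "x \<in> S" for x
  proof -
    \<comment> \<open>The lower part of a Dedekind cut for the value at \<open>x\<close>. Its
      supremum \<open>s\<close> is the value: below \<open>s\<close> membership in \<open>M\<close>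
      holds, and above it totality of \<open>M\<close> gives the opposite sign.\<close>
    define R where "R = {r. x - r *\<^sub>R 1 \<in> M}"
    have "norm x *\<^sub>R 1 - (- x) \<in> P"
      by (rule norm_minus_P) (use x in auto)
    then have "- norm x \<in> R"
      using PM by (simp add: R_def add.commute)
    have bound: "r \<le> norm x" if "r \<in> R" for r
    proof (rule ccontr)
      assume r: "\<not> r \<le> norm x"
      have "(x - r *\<^sub>R 1) + (norm x *\<^sub>R 1 - x) \<in> M"
        using that x by (intro add[OF _ PM[OF norm_minus_P]]) (auto simp: R_def)
      then have "(norm x - r) *\<^sub>R 1 \<in> M"
        by (simp add: algebra_simps)
      with neg[of "norm x - r"] r show False by auto
    qed
    define s where "s = Sup R"
    have bdd: "bdd_above R" using bound by (rule bdd_aboveI)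
    have down: "r \<in> R" if "r < s" for r
    proof -
      obtain r' where r': "r' \<in> R" "r < r'"
        using less_cSupE[of r R] \<open>r < s\<close> \<open>- norm x \<in> R\<close> unfolding s_def by blast
      then have "(x - r' *\<^sub>R 1) + (r' - r) *\<^sub>R 1 \<in> M"
        by (intro add[OF _ PM]) (auto simp: R_def)
      then show ?thesis by (simp add: R_def algebra_simps)
    qed
    have "e *\<^sub>R 1 + (x - s *\<^sub>R 1) \<in> M \<and> e *\<^sub>R 1 - (x - s *\<^sub>R 1) \<in> M" if "e > 0" for e
    proof
      show "e *\<^sub>R 1 + (x - s *\<^sub>R 1) \<in> M"
        using down[of "s - e"] that by (simp add: R_def algebra_simps)
      have "s + e \<notin> R"
        using cSup_upper[of "s + e" R] bdd that by (auto simp: s_def)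
      then have "- (x - (s + e) *\<^sub>R 1) \<in> M"
        using total[of "x - (s + e) *\<^sub>R 1"] x by (auto simp: R_def)
      then show "e *\<^sub>R 1 - (x - s *\<^sub>R 1) \<in> M"
        by (simp add: algebra_simps)
    qed
    then show ?thesis using x by (auto simp: J_def)
  qed
  define f where "f x = (SOME r. x - r *\<^sub>R 1 \<in> J)" for x
  have f: "x - f x *\<^sub>R 1 \<in> J" if "x \<in> S" for x
    unfolding f_def using someI_ex[OF ex[OF that]] .
  have f_eq: "f x = r" if "x \<in> S" "x - r *\<^sub>R 1 \<in> J" for x r
  proof -
    have "(x - r *\<^sub>R 1) + - (x - f x *\<^sub>R 1) \<in> J"
      using f that by (intro J_add J_uminus) auto
    then have "(f x - r) *\<^sub>R 1 \<in> J" by (simp add: algebra_simps)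
    then show ?thesis using J_const by fastforce
  qed
  show ?thesis
  proof (rule that[of f])
    show "f 1 = 1" by (rule f_eq) (use J0 in auto)
    show "f (x + y) = f x + f y" if "x \<in> S" "y \<in> S" for x y
    proof (rule f_eq)
      have "(x - f x *\<^sub>R 1) + (y - f y *\<^sub>R 1) \<in> J" using that by (intro J_add f) auto
      then show "x + y - (f x + f y) *\<^sub>R 1 \<in> J" by (simp add: algebra_simps)
    qed (use that in auto)
    show "f (r *\<^sub>R x) = r * f x" if "x \<in> S" for x r
    proof (rule f_eq)
      have "(r *\<^sub>R 1) * (x - f x *\<^sub>R 1) \<in> J" using that by (intro J_mult f) auto
      then show "r *\<^sub>R x - (r * f x) *\<^sub>R 1 \<in> J" by (simp add: algebra_simps)
    qed (use that in auto)
    show "f (x * y) = f x * f y" if "x \<in> S" "y \<in> S" for x y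
    proof (rule f_eq)
      have "y * (x - f x *\<^sub>R 1) + (f x *\<^sub>R 1) * (y - f y *\<^sub>R 1) \<in> J"
        using that by (intro J_add J_mult f) auto
      then show "x * y - (f x * f y) *\<^sub>R 1 \<in> J"
        using commute[of x y] that by (simp add: algebra_simps)
    qed (use that in auto)
    show "f a \<le> 0"
    proof (rule ccontr)
      assume "\<not> f a \<le> 0"
      \<comment> \<open>With error \<open>f a/2\<close>, adding \<open>- a\<close>, which lies in
        \<open>M\<close>, cancels \<open>a\<close> and leaves the negative constant
        \<open>- f a/2\<close> in \<open>M\<close>.\<close>
      then have "(f a/2) *\<^sub>R 1 + (a - f a *\<^sub>R 1) \<in> M"
        by (intro J(2) f a(1)) simp
      from add[OF this subsetD[OF M(2) Q(2)]]
      have "((f a/2) *\<^sub>R 1 + (a - f a *\<^sub>R 1)) + (- a) \<in> M" .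
      then have "(f a/2) *\<^sub>R 1 - f a *\<^sub>R 1 \<in> M"
        by simp
      then have "(f a/2 - f a) *\<^sub>R 1 \<in> M"
        by (simp only: scaleR_diff_left)
      with neg[of "f a/2 - f a"] \<open>\<not> f a \<le> 0\<close> show False by auto
    qed
  qed
qed

subsection \<open>Characters detect positivity\<close>

abbreviation X :: "('a \<Rightarrow> complex) set" where "X \<equiv> characters C"

lemma char_one [simp]: "l \<in> X \<Longrightarrow> l 1 = 1"
  and char_add [simp]: "l \<in> X \<Longrightarrow> x \<in> C \<Longrightarrow> y \<in> C \<Longrightarrow> l (x + y) = l x + l y"
  and char_scaleC [simp]: "l \<in> X \<Longrightarrow> x \<in> C \<Longrightarrow> l (c *\<^sub>C x) = c * l x"
  and char_mult [simp]: "l \<in> X \<Longrightarrow> x \<in> C \<Longrightarrow> y \<in> C \<Longrightarrow> l (x * y) = l x * l y"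
  by (simp_all add: characters_def)

lemma char_scaleR [simp]: "l \<in> X \<Longrightarrow> x \<in> C \<Longrightarrow> l (r *\<^sub>R x) = complex_of_real r * l x"
  by (simp add: scaleR_scaleC)

lemma char_zero [simp]: "l \<in> X \<Longrightarrow> l 0 = 0"
  using char_scaleC[of l 0 0] by simp

lemma char_minus [simp]: "l \<in> X \<Longrightarrow> x \<in> C \<Longrightarrow> l (- x) = - l x"
  using char_scaleC[of l x "- 1"] by (simp add: scaleC_minus_left)

lemma char_diff [simp]: "l \<in> X \<Longrightarrow> x \<in> C \<Longrightarrow> y \<in> C \<Longrightarrow> l (x - y) = l x - l y"
  using char_add[of l x "- y"] by simp

lemmas char_simps = char_one char_add char_scaleC char_mult char_scaleR char_zero char_minus char_diff

lemma char_extensional: "l \<in> X \<Longrightarrow> l \<in> extensional C"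
  by (simp add: characters_def del: char_simps)

text \<open>The Neumann series \<open>w\<close> for the inverse of \<open>1 - z\<close> stays in the
  closed algebra and satisfies \<open>w = z * w + 1\<close>; a character with value 1 at
  \<open>z\<close> would give \<open>l w = l w + 1\<close>.\<close>

lemma char_neq_one:
  assumes l: "l \<in> X" and z: "z \<in> C" "norm z < 1"
  shows "l z \<noteq> 1"
proof
  assume lz: "l z = 1"
  have le: "norm (z ^ n) \<le> norm z ^ n" for n
  proof (induction n)
    case (Suc n)
    then show ?case
      using order_trans[OF norm_mult_ineq mult_left_mono[OF Suc norm_ge_zero]] by simp
  qed (simp add: norm_one_le)
  have summ: "summable (\<lambda>n. z ^ n)"
    by (rule summable_comparison_test[of _ "\<lambda>n. norm z ^ n"])
       (use le z in \<open>auto intro: summable_geometric\<close>)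
  define w where "w = (\<Sum>n. z ^ n)"
  have pow: "z ^ n \<in> C" for n
    by (induction n) (simp_all add: z)
  have "(\<Sum>i<n. z ^ i) \<in> C" for n
    by (induction n) (simp_all add: pow)
  then have w: "w \<in> C"
    using closed_sequentially[OF closed_C, of "\<lambda>n. \<Sum>i<n. z ^ i" w] summable_LIMSEQ[OF summ]
    by (simp add: w_def)
  have "w = z * w + 1"
    unfolding w_def suminf_mult[OF summ, symmetric]
    using suminf_split_head[OF summ] by simp
  then have "l w = l (z * w + 1)" by (rule arg_cong)
  then have "l w = l w + 1" using l z w lz by simp
  then show False by simp
qed

text \<open>Automatic continuity of an algebraically defined character: if the bound failed,
  \<open>x\<close> divided by \<open>l x\<close> would have norm below one and value one.\<close>

lemma char_norm_le:
  assumes l: "l \<in> X" and x: "x \<in> C"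
  shows "cmod (l x) \<le> norm x"
proof (rule ccontr)
  assume gt: "\<not> ?thesis"
  then have nz: "l x \<noteq> 0" by auto
  have "norm (inverse (l x) *\<^sub>C x) < 1"
  proof -
    have "norm (inverse (l x) *\<^sub>C x) = norm x / cmod (l x)"
      by (simp add: norm_scaleC norm_inverse divide_inverse mult.commute)
    also have "\<dots> < 1"
      using gt nz by (simp add: divide_less_eq)
    finally show ?thesis .
  qed
  moreover have "l (inverse (l x) *\<^sub>C x) = 1"
    using l x nz by simp
  ultimately show False
    using char_neq_one[OF l] x by simp
qed

text \<open>With \<open>l h = \<alpha> + i \<beta>\<close>, the bound \<open>\<bar>l (h + i t)\<bar>\<^sup>2 \<le> \<parallel>h\<^sup>2 + t\<^sup>2\<parallel>\<close> gives
  \<open>\<alpha>\<^sup>2 + (\<beta> + t)\<^sup>2 \<le> \<parallel>h\<parallel>\<^sup>2 + t\<^sup>2\<close> for all real \<open>t\<close>.\<close>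

lemma char_real:
  assumes l: "l \<in> X" and h: "h \<in> S"
  shows "Im (l h) = 0"
proof (rule ccontr)
  assume b: "Im (l h) \<noteq> 0"
  \<comment> \<open>This makes \<open>2 * Im (l h) * t\<close> equal to
    \<open>(norm h)\<^sup>2 + 1\<close>, one more than the inequality permits.\<close>
  define t where "t = ((norm h)\<^sup>2 + 1) / (2 * Im (l h))"
  define u where "u = h + \<i> *\<^sub>C (t *\<^sub>R 1)"
  have "(cmod (l u))\<^sup>2 \<le> (norm u)\<^sup>2"
    using char_norm_le[OF l, of u] h by (intro power_mono) (auto simp: u_def)
  also have "\<dots> = norm (h * h + (t *\<^sub>R 1) * (t *\<^sub>R 1))"
    unfolding cstar_identity[symmetric] u_def using h by (subst adj_mult_self) auto
  also have "\<dots> \<le> norm h * norm h + t * t * norm (1::'a)"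
    using norm_triangle_ineq[of "h * h" "(t *\<^sub>R 1) * (t *\<^sub>R 1)"] norm_mult_ineq[of h h] by simp
  also have "\<dots> \<le> norm h * norm h + t * t * 1"
    by (intro add_left_mono mult_left_mono norm_one_le) simp
  finally have "(cmod (l u))\<^sup>2 \<le> (norm h)\<^sup>2 + t\<^sup>2"
    by (simp add: power2_eq_square)
  moreover have "l u = l h + \<i> * t"
    using l h by (simp add: u_def)
  ultimately have "(Re (l h))\<^sup>2 + (Im (l h) + t)\<^sup>2 \<le> (norm h)\<^sup>2 + t\<^sup>2"
    by (simp add: cmod_power2)
  then have "2 * Im (l h) * t \<le> (norm h)\<^sup>2 - (Re (l h))\<^sup>2 - (Im (l h))\<^sup>2"
    by (simp add: power2_eq_square algebra_simps)
  also have "2 * Im (l h) * t = (norm h)\<^sup>2 + 1"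
    using b by (simp add: t_def)
  finally show False
    using zero_le_power2[of "Re (l h)"] zero_le_power2[of "Im (l h)"] by linarith
qed

lemma char_P_nonneg:
  assumes "l \<in> X" "x \<in> P"
  shows "Re (l x) \<ge> 0"
proof -
  obtain s where s: "s \<in> P" "s * s = x" using P_sqrt[OF assms(2)] .
  then have "l x = l s * l s" using char_mult[of l s s] assms by simp
  then show ?thesis using char_real[of l s] assms s by simp
qed

section \<open>From real functionals to characters\<close>

definition re_part :: "'a \<Rightarrow> 'a" where
  "re_part x = (1/2) *\<^sub>R (x + adj x)"

definition im_part :: "'a \<Rightarrow> 'a" where
  "im_part x = (1/2) *\<^sub>R ((-\<i>) *\<^sub>C (x - adj x))"

lemma re_part_eq: "h \<in> S \<Longrightarrow> k \<in> S \<Longrightarrow> re_part (h + \<i> *\<^sub>C k) = h"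
  by (simp add: re_part_def adj_add adj_scaleC scaleC_minus_left flip: scaleR_2)

lemma im_part_eq:
  assumes "h \<in> S" "k \<in> S"
  shows "im_part (h + \<i> *\<^sub>C k) = k"
proof -
  have "(h + \<i> *\<^sub>C k) - adj (h + \<i> *\<^sub>C k) = (2 * \<i>) *\<^sub>C k"
    using assms by (simp add: adj_add adj_scaleC scaleC_minus_left flip: scaleC_add_left)
  then show ?thesis
    by (simp add: im_part_def scaleR_scaleC scaleC_scaleC)
qed

text \<open>Complexification: real and imaginary parts are unique, so
  \<open>f h + \<i> * f k\<close> is well defined, and its algebraic rules follow by comparing
  parts.\<close>

lemma character_of_real_character:
  fixes f :: "'a \<Rightarrow> real"
  assumes one: "f 1 = 1"
    and add: "\<And>x y. x \<in> S \<Longrightarrow> y \<in> S \<Longrightarrow> f (x + y) = f x + f y"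
    and scale: "\<And>x r. x \<in> S \<Longrightarrow> f (r *\<^sub>R x) = r * f x"
    and mult: "\<And>x y. x \<in> S \<Longrightarrow> y \<in> S \<Longrightarrow> f (x * y) = f x * f y"
  obtains l where "l \<in> X" "\<And>x. x \<in> S \<Longrightarrow> l x = complex_of_real (f x)"
proof -
  define l where "l = (\<lambda>x\<in>C. Complex (f (re_part x)) (f (im_part x)))"
  have l: "l (h + \<i> *\<^sub>C k) = Complex (f h) (f k)" if "h \<in> S" "k \<in> S" for h k
    using that by (simp add: l_def re_part_eq im_part_eq)
  have diff: "f (x - y) = f x - f y" if "x \<in> S" "y \<in> S" for x y
    using add[of "x - y" y] that by simp
  have zero: "f 0 = 0" using add[of 0 0] by simp
  have lS: "l x = complex_of_real (f x)" if "x \<in> S" for x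
    using l[of x 0] that zero by (simp add: complex_of_real_def)
  have "l \<in> X"
    unfolding characters_def
  proof (intro CollectI conjI ballI allI)
    show "l \<in> extensional C" by (simp add: l_def)
    show "l 1 = 1" using lS[of 1] one by simp
  next
    fix x y assume "x \<in> C" "y \<in> C"
    then obtain h k h' k' where hk: "h \<in> S" "k \<in> S" "x = h + \<i> *\<^sub>C k" "h' \<in> S" "k' \<in> S" "y = h' + \<i> *\<^sub>C k'"
      using real_imaginary_parts by metis
    have "x + y = (h + h') + \<i> *\<^sub>C (k + k')"
      using hk by (simp add: scaleC_add_right)
    then have "l (x + y) = Complex (f (h + h')) (f (k + k'))"
      using hk(1,2,4,5) by (simp only: l S_add)
    then show "l (x + y) = l x + l y"
      unfolding hk(3,6) using hk(1,2,4,5) by (simp add: l add complex_eq_iff)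
    have "x * y = (h * h' - k * k') + \<i> *\<^sub>C (h * k' + k * h')"
      unfolding hk by (simp add: distrib_left distrib_right mult_scaleC_left mult_scaleC_right scaleC_scaleC
          scaleC_add_right scaleC_minus_left)
    then have "l (x * y) = Complex (f (h * h' - k * k')) (f (h * k' + k * h'))"
      using hk(1,2,4,5) by (simp only: l S_add S_diff S_mult)
    then show "l (x * y) = l x * l y"
      unfolding hk(3,6) using hk(1,2,4,5) by (simp add: l add mult diff complex_eq_iff)
  next
    fix c x assume "x \<in> C"
    then obtain h k where hk: "h \<in> S" "k \<in> S" "x = h + \<i> *\<^sub>C k"
      using real_imaginary_parts by metis
    have "c *\<^sub>C x = (Re c *\<^sub>R h - Im c *\<^sub>R k) + \<i> *\<^sub>C (Re c *\<^sub>R k + Im c *\<^sub>R h)"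
    proof -
      have c: "c = complex_of_real (Re c) + \<i> * complex_of_real (Im c)"
        and ci: "c * \<i> = \<i> * complex_of_real (Re c) + - complex_of_real (Im c)"
        by (simp_all add: complex_eq_iff)
      have "c *\<^sub>C x = c *\<^sub>C h + (c * \<i>) *\<^sub>C k"
        by (simp add: hk(3) scaleC_add_right scaleC_scaleC)
      also have "c *\<^sub>C h = Re c *\<^sub>R h + \<i> *\<^sub>C (Im c *\<^sub>R h)"
        by (subst c) (simp only: scaleR_scaleC scaleC_add_left scaleC_scaleC)
      also have "(c * \<i>) *\<^sub>C k = \<i> *\<^sub>C (Re c *\<^sub>R k) - Im c *\<^sub>R k"
        unfolding ci scaleC_add_left by (simp add: scaleR_scaleC scaleC_scaleC scaleC_minus_left)
      finally show ?thesis
        by (simp add: scaleC_add_right)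
    qed
    then have "l (c *\<^sub>C x) = Complex (f (Re c *\<^sub>R h - Im c *\<^sub>R k)) (f (Re c *\<^sub>R k + Im c *\<^sub>R h))"
      using hk(1,2) by (simp only: l S_add S_diff S_scaleR)
    then show "l (c *\<^sub>C x) = c * l x"
      unfolding hk(3) using hk(1,2) by (simp add: l add diff scale complex_eq_iff)
  qed
  with lS show ?thesis using that by blast
qed

text \<open>If \<open>x\<close> is outside the cone, so is some \<open>x + e *\<^sub>R 1\<close>, by
  closedness. A functional that is at most zero there is at most \<open>- e\<close> at
  \<open>x\<close>, which supplies the strict inequality.\<close>

lemma P_iff_char:
  assumes "x \<in> S"
  shows "x \<in> P \<longleftrightarrow> (\<forall>l\<in>X. Re (l x) \<ge> 0)"
proof
  assume "\<forall>l\<in>X. Re (l x) \<ge> 0"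
  show "x \<in> P"
  proof (rule ccontr)
    assume "x \<notin> P"
    then obtain e where e: "e > 0" "x + e *\<^sub>R 1 \<notin> P"
      using P_closed assms by blast
    have xe: "x + e *\<^sub>R 1 \<in> S" using assms by simp
    obtain f :: "'a \<Rightarrow> real" where f: "f 1 = 1" "f (x + e *\<^sub>R 1) \<le> 0"
      "\<And>x y. x \<in> S \<Longrightarrow> y \<in> S \<Longrightarrow> f (x + y) = f x + f y"
      "\<And>x r. x \<in> S \<Longrightarrow> f (r *\<^sub>R x) = r * f x"
      "\<And>x y. x \<in> S \<Longrightarrow> y \<in> S \<Longrightarrow> f (x * y) = f x * f y"
      using real_character_exists[OF xe e(2)] by blast
    obtain l where l: "l \<in> X" "\<And>x. x \<in> S \<Longrightarrow> l x = complex_of_real (f x)"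
      using character_of_real_character[of f] f by blast
    have "f (x + e *\<^sub>R 1) = f x + e"
      using f(3)[of x "e *\<^sub>R 1"] f(4)[of 1 e] f(1) assms by simp
    with f(2) e(1) have "Re (l x) < 0"
      using l(2)[OF assms] by simp
    with \<open>\<forall>l\<in>X. Re (l x) \<ge> 0\<close> l(1) show False by fastforce
  qed
qed (auto intro: char_P_nonneg)

lemma S_eq_iff_char:
  assumes "x \<in> S" "y \<in> S" "\<And>l. l \<in> X \<Longrightarrow> Re (l x) = Re (l y)"
  shows "x = y"
proof -
  have "x - y \<in> P" "- (x - y) \<in> P"
    using assms by (simp_all add: P_iff_char)
  then have "x - y = 0" by (rule P_antisym)
  then show ?thesis by simp
qed

lemma char_adj_mult_self:
  assumes "l \<in> X" "x \<in> C"
  shows "Re (l (adj x * x)) = (cmod (l x))\<^sup>2"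
proof -
  obtain h k where hk: "h \<in> S" "k \<in> S" "x = h + \<i> *\<^sub>C k"
    using real_imaginary_parts[OF assms(2)] .
  then show ?thesis
    using assms(1) char_real[OF assms(1) hk(1)] char_real[OF assms(1) hk(2)]
    by (simp add: adj_mult_self cmod_power2) (simp add: power2_eq_square)
qed

subsection \<open>Positive parts\<close>

text \<open>The witness is \<open>(|a| + a) / 2\<close> with \<open>|a|\<close> the positive root of
  \<open>a * a\<close>. Characters reduce both positivity claims to real numbers, and the product is
  a multiple of \<open>|a|^2 - a^2\<close>.\<close>

lemma positive_part_exists:
  assumes a: "a \<in> S"
  obtains p where "p \<in> P" "p - a \<in> P" "p * (p - a) = 0"
proof -
  obtain s where s: "s \<in> P" "s * s = a * a"
    using P_sqrt[OF square_P[OF a]] .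
  define p where "p = (1/2) *\<^sub>R (s + a)"
  have pS: "p \<in> S" using s a by (simp add: p_def)
  have abs: "\<bar>Re (l a)\<bar> = Re (l s)" if "l \<in> X" for l
  proof -
    have "l s * l s = l a * l a"
      using char_mult[of l s s] char_mult[of l a a] that s a by simp
    then have "(Re (l s))\<^sup>2 = (Re (l a))\<^sup>2"
      using char_real[of l s] char_real[of l a] that s a
      by (simp add: complex_eq_iff power2_eq_square)
    then show ?thesis
      using char_P_nonneg[OF that s(1)] by (metis abs_of_nonneg power2_eq_iff abs_minus_cancel)
  qed
  have lp: "Re (l p) = (Re (l s) + Re (l a)) / 2" if "l \<in> X" for l
    using that s a by (simp add: p_def)
  have "Re (l p) \<ge> 0 \<and> Re (l (p - a)) \<ge> 0" if "l \<in> X" for l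
    using abs[OF that] lp[OF that] that pS a by (auto simp: abs_if split: if_splits)
  then have "p \<in> P" "p - a \<in> P"
    using P_iff_char[of p] P_iff_char[of "p - a"] pS a by simp_all
  moreover have "p - a = (1/2) *\<^sub>R (s - a)"
    by (simp add: p_def algebra_simps flip: scaleR_add_left)
  then have "p * (p - a) = (1/4) *\<^sub>R ((s + a) * (s - a))"
    by (simp add: p_def)
  then have "p * (p - a) = 0"
    using commute[of s a] s a by (simp add: algebra_simps)
  ultimately show ?thesis using that by blast
qed

text \<open>The values of \<open>p\<close> and \<open>p - a\<close> are nonnegative and one of them
  vanishes. As characters separate selfadjoint elements, this also shows that the positive part is
  unique.\<close>

lemma char_positive_part_eq:
  assumes "a \<in> S" "p \<in> P" "p - a \<in> P" "p * (p - a) = 0" "l \<in> X"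
  shows "Re (l p) = max (Re (l a)) 0"
proof -
  have "l p * l (p - a) = 0"
    using char_mult[of l p "p - a"] assms by simp
  then have "Re (l p) = 0 \<or> Re (l (p - a)) = 0"
    by auto
  then show ?thesis
    using char_P_nonneg[OF assms(5,2)] char_P_nonneg[OF assms(5,3)] assms by auto
qed

lemma positive_part:
  assumes a: "a \<in> S"
  shows "positive_part C a \<in> P"
    and "l \<in> X \<Longrightarrow> Re (l (positive_part C a)) = max (Re (l a)) 0"
proof -
  obtain p where p: "p \<in> P" "p - a \<in> P" "p * (p - a) = 0"
    using positive_part_exists[OF a] .
  have "positive_part C a = p"
    unfolding positive_part_def
  proof (rule the_equality)
    fix q assume "q \<in> P \<and> q - a \<in> P \<and> q * (q - a) = 0"
    then show "q = p"
      using p a char_positive_part_eq by (intro S_eq_iff_char) auto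
  qed (use p in blast)
  then show "positive_part C a \<in> P" "l \<in> X \<Longrightarrow> Re (l (positive_part C a)) = max (Re (l a)) 0"
    using p char_positive_part_eq[OF a p] by auto
qed

lemma positive_part_P:
  assumes "a \<in> P" shows "positive_part C a = a"
  using assms by (intro S_eq_iff_char) (auto simp: positive_part char_P_nonneg)

end

section \<open>The spectrum and its regular ideals\<close>

lemma partial_orderI:
  fixes L :: "('b, 'm) gorder_scheme" (structure)
  assumes "eq L = (=)"
    and "\<And>x. x \<in> carrier L \<Longrightarrow> x \<sqsubseteq> x"
    and "\<And>x y. x \<in> carrier L \<Longrightarrow> y \<in> carrier L \<Longrightarrow> x \<sqsubseteq> y \<Longrightarrow> y \<sqsubseteq> x \<Longrightarrow> x = y"
    and "\<And>x y z. x \<in> carrier L \<Longrightarrow> y \<in> carrier L \<Longrightarrow> z \<in> carrier L \<Longrightarrow> x \<sqsubseteq> y \<Longrightarrow> y \<sqsubseteq> z \<Longrightarrow> x \<sqsubseteq> z"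
  shows "partial_order L"
  by unfold_locales (auto simp only: assms(1) intro: assms(2-))

text \<open>Values at selfadjoint elements are real, so \<open>Re\<close> only changes the type.
  Outside the cone this is the set where the element is strictly positive, rather than nonzero; it
  is used in this way for the covers below.\<close>

definition coz :: "'a::unital_cstar_algebra set \<Rightarrow> 'a \<Rightarrow> ('a \<Rightarrow> complex) set" where
  "coz C a = {l \<in> characters C. Re (l a) > 0}"

definition ideal_of_open :: "'a::unital_cstar_algebra set \<Rightarrow> ('a \<Rightarrow> complex) set \<Rightarrow> 'a set set" where
  "ideal_of_open C W = {approx_rel C `` {a} | a. a \<in> positive_cone C \<and> coz C a \<subseteq> W}"

definition open_of_ideal :: "'a::unital_cstar_algebra set \<Rightarrow> 'a set set \<Rightarrow> ('a \<Rightarrow> complex) set" where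
  "open_of_ideal C I = (\<Union>a\<in>{a \<in> positive_cone C. approx_rel C `` {a} \<in> I}. coz C a)"

lemma closedin_Collect_ball:
  assumes "\<And>i. i \<in> I \<Longrightarrow> closedin T {l \<in> topspace T. Q i l}"
  shows "closedin T {l \<in> topspace T. \<forall>i\<in>I. Q i l}"
proof (cases "I = {}")
  case False
  have "{l \<in> topspace T. \<forall>i\<in>I. Q i l} = (\<Inter>i\<in>I. {l \<in> topspace T. Q i l})"
    using False by auto
  then show ?thesis
    using False assms by (auto intro!: closedin_Inter)
qed simp

context comm_cstar
begin

subsection \<open>The topology of the spectrum\<close>

lemma topspace_gelfand_spectrum [simp]: "topspace (gelfand_spectrum C) = X"
  using char_extensional by (auto simp: gelfand_spectrum_def PiE_def)

lemma continuous_map_char_eval: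
  "x \<in> C \<Longrightarrow> continuous_map (gelfand_spectrum C) euclidean (\<lambda>l. l x)"
  unfolding gelfand_spectrum_def
  by (intro continuous_map_from_subtopology continuous_map_product_projection)

lemma openin_coz:
  assumes "x \<in> C"
  shows "openin (gelfand_spectrum C) (coz C x)"
proof -
  have "open {z::complex. Re z > 0}"
    by (simp add: open_halfspace_Re_gt)
  then show ?thesis
    using openin_continuous_map_preimage[OF continuous_map_char_eval[OF assms], of "{z. Re z > 0}"]
    by (simp add: coz_def)
qed

text \<open>As in the Banach-Alaoglu theorem: the norm bound puts the characters into a product of
  discs, compact by Tychonoff, and their defining equations between evaluations are closed
  conditions.\<close>

lemma compact_space_gelfand_spectrum: "compact_space (gelfand_spectrum C)"
proof -
  let ?T = "product_topology (\<lambda>_. euclidean :: complex topology) C"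
  let ?K = "\<Pi>\<^sub>E x\<in>C. cball (0::complex) (norm x)"
  have ev: "continuous_map ?T euclidean (\<lambda>l. l x)" if "x \<in> C" for x
    using that by (rule continuous_map_product_projection)
  have closed: "closedin ?T {l \<in> topspace ?T. f l = g l}"
    if "continuous_map ?T euclidean f" "continuous_map ?T euclidean g" for f g :: "_ \<Rightarrow> complex"
    using that by (intro closedin_continuous_maps_eq[OF Hausdorff_space_euclidean])
  have mult: "continuous_map ?T euclidean (\<lambda>l. f l * g l)"
    if "continuous_map ?T euclidean f" "continuous_map ?T euclidean g" for f g :: "_ \<Rightarrow> complex"
    using that by (simp add: continuous_map_atin tendsto_mult)
  have X_eq: "X = {l \<in> topspace ?T. l 1 = 1} \<inter>
      {l \<in> topspace ?T. \<forall>x\<in>C. \<forall>y\<in>C. l (x + y) = l x + l y} \<inter>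
      {l \<in> topspace ?T. \<forall>c\<in>UNIV. \<forall>x\<in>C. l (c *\<^sub>C x) = c * l x} \<inter>
      {l \<in> topspace ?T. \<forall>x\<in>C. \<forall>y\<in>C. l (x * y) = l x * l y}"
    by (auto simp: characters_def PiE_def simp del: char_simps)
  have 1: "closedin ?T {l \<in> topspace ?T. \<forall>x\<in>C. \<forall>y\<in>C. l (x + y) = l x + l y}"
    by (intro closedin_Collect_ball closed continuous_map_add ev) simp_all
  have 2: "closedin ?T {l \<in> topspace ?T. \<forall>c\<in>UNIV. \<forall>x\<in>C. l (c *\<^sub>C x) = c * l x}"
    by (intro closedin_Collect_ball closed mult ev) simp_all
  have 3: "closedin ?T {l \<in> topspace ?T. \<forall>x\<in>C. \<forall>y\<in>C. l (x * y) = l x * l y}"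
    by (intro closedin_Collect_ball closed mult ev) simp_all
  have 4: "closedin ?T {l \<in> topspace ?T. l 1 = 1}"
    by (intro closed ev) simp_all
  have "closedin ?T X"
    unfolding X_eq by (intro closedin_Int 1 2 3 4)
  moreover have "X \<subseteq> ?K"
    using char_norm_le char_extensional by (auto simp: PiE_def)
  moreover have "compactin ?T ?K"
    by (simp add: compactin_PiE)
  ultimately have "compactin ?T X"
    using closed_compactin by metis
  then show ?thesis
    unfolding gelfand_spectrum_def by (rule compact_space_subtopology)
qed

lemma char_sum: "finite F \<Longrightarrow> l \<in> X \<Longrightarrow> (\<And>i. i \<in> F \<Longrightarrow> f i \<in> C) \<Longrightarrow> l (sum f F) = (\<Sum>i\<in>F. l (f i)) \<and> sum f F \<in> C"
  by (induction F rule: finite_induct) auto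

lemma adj_mult_P: "x \<in> C \<Longrightarrow> adj x * x \<in> P"
  unfolding positive_cone_def by blast

lemma P_sum: "(\<And>i. i \<in> F \<Longrightarrow> f i \<in> P) \<Longrightarrow> sum f F \<in> P"
  by (induction F rule: infinite_finite_induct) auto

text \<open>The cozero set of \<open>(e\<^sup>2 - \<Sum>\<^sub>x \<bar>x - l(x)\<bar>\<^sup>2)\<^sup>+\<close> lies in the basic neighbourhood of \<open>l\<close> given by the
  radius \<open>e\<close> and the finitely many evaluations at \<open>x\<close>.\<close>

lemma coz_basis:
  assumes W: "openin (gelfand_spectrum C) W" and l: "l \<in> W"
  obtains a where "a \<in> P" "l \<in> coz C a" "coz C a \<subseteq> W"
proof -
  have lX: "l \<in> X" using openin_subset[OF W] l by auto
  obtain T where T: "openin (product_topology (\<lambda>_. euclidean) C) T" "W = T \<inter> X"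
    using W by (auto simp: gelfand_spectrum_def openin_subtopology)
  have "l \<in> T" using l T(2) by simp
  with T(1) have "\<exists>U. finite {i \<in> C. U i \<noteq> UNIV} \<and> (\<forall>i\<in>C. open (U i)) \<and> l \<in> Pi\<^sub>E C U \<and> Pi\<^sub>E C U \<subseteq> T"
    unfolding openin_product_topology_alt topspace_euclidean open_openin[symmetric] by (rule bspec)
  then obtain U where U: "finite {i \<in> C. U i \<noteq> UNIV}" "\<forall>i\<in>C. open (U i)"
      "l \<in> Pi\<^sub>E C U" "Pi\<^sub>E C U \<subseteq> T"
    by (elim exE conjE)
  define F where "F = {i \<in> C. U i \<noteq> UNIV}"
  have F: "finite F" "F \<subseteq> C" using U(1) by (auto simp: F_def)
  have "\<exists>e>0. \<forall>x\<in>G. ball (l x) e \<subseteq> U x" if "finite G" "G \<subseteq> C" for G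
    using that
  proof (induction G rule: finite_induct)
    case empty
    show ?case by (auto intro: exI[of _ 1])
  next
    case (insert y G)
    then obtain e where e: "e > 0" "\<And>x. x \<in> G \<Longrightarrow> ball (l x) e \<subseteq> U x" by auto
    obtain d where d: "d > 0" "ball (l y) d \<subseteq> U y"
      using bspec[OF U(2), of y] PiE_mem[OF U(3), of y] insert.prems
        open_contains_ball[THEN iffD1, THEN bspec, of "U y" "l y"] by auto
    show ?case
    proof (intro exI[of _ "min d e"] conjI ballI)
      fix x assume "x \<in> insert y G"
      then show "ball (l x) (min d e) \<subseteq> U x"
        using e(2)[of x] d(2) subset_ball[of "min d e" d] subset_ball[of "min d e" e] by fastforce
    qed (use e d in simp)
  qed
  from this[OF F] obtain e where e: "e > 0" "\<And>x. x \<in> F \<Longrightarrow> ball (l x) e \<subseteq> U x" by auto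
  \<comment> \<open>The coordinates need not be selfadjoint, so closeness is measured by
    \<open>adj (g x) * g x\<close>, whose value at \<open>m\<close> is the squared distance from
    \<open>m x\<close> to \<open>l x\<close>.\<close>
  define g where "g x = x - l x *\<^sub>C 1" for x
  have gC: "g x \<in> C" if "x \<in> C" for x using that by (simp add: g_def)
  define b where "b = (\<Sum>x\<in>F. adj (g x) * g x)"
  have gP: "adj (g x) * g x \<in> P" if "x \<in> F" for x
    using gC[of x] that F by (auto intro: adj_mult_P)
  have bP: "b \<in> P" unfolding b_def by (rule P_sum[OF gP])
  have mb: "Re (m b) = (\<Sum>x\<in>F. (cmod (m x - l x))\<^sup>2)" if m: "m \<in> X" for m
  proof -
    have "m b = (\<Sum>x\<in>F. m (adj (g x) * g x))"
      unfolding b_def using char_sum[OF F(1) m, of "\<lambda>x. adj (g x) * g x"] gP by simp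
    moreover have "Re (m (adj (g x) * g x)) = (cmod (m x - l x))\<^sup>2" if "x \<in> F" for x
      using char_adj_mult_self[OF m gC] that F m by (auto simp: g_def)
    ultimately show ?thesis by simp
  qed
  define c where "c = e\<^sup>2 *\<^sub>R 1 - b"
  have cS: "c \<in> S" using bP by (simp add: c_def)
  define a where "a = positive_part C c"
  have coz: "m \<in> coz C a \<longleftrightarrow> m \<in> X \<and> Re (m b) < e\<^sup>2" for m
    using positive_part(2)[OF cS, of m] bP by (auto simp: coz_def a_def c_def)
  show ?thesis
  proof (rule that[of a])
    show "a \<in> P" unfolding a_def by (rule positive_part(1)[OF cS])
    show "l \<in> coz C a" using coz mb[OF lX] lX e(1) by simp
    show "coz C a \<subseteq> W"
    proof
      fix m assume "m \<in> coz C a"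
      then have m: "m \<in> X" "Re (m b) < e\<^sup>2" using coz by auto
      have "m x \<in> U x" if x: "x \<in> C" for x
      proof (cases "x \<in> F")
        case True
        have "(cmod (m x - l x))\<^sup>2 \<le> Re (m b)"
          unfolding mb[OF m(1)] using member_le_sum[OF True, of "\<lambda>x. (cmod (m x - l x))\<^sup>2"] F by simp
        then have "(cmod (m x - l x))\<^sup>2 < e\<^sup>2" using m(2) by linarith
        then have "cmod (m x - l x) < e" using e(1) by (simp add: power2_less_imp_less)
        then have "m x \<in> ball (l x) e" by (simp add: dist_norm norm_minus_commute)
        then show ?thesis using e(2)[OF True] by auto
      qed (use x in \<open>auto simp: F_def\<close>)
      moreover have "m \<in> extensional C" using m(1) by (rule char_extensional)
      ultimately have "m \<in> Pi\<^sub>E C U" by (auto simp: PiE_def)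
      then show "m \<in> W" using U(4) T(2) m(1) by auto
    qed
  qed
qed

subsection \<open>The lattice of a commutative algebra\<close>

text \<open>A real factor may be rounded up to a natural number because \<open>b\<close> is
  positive.\<close>

lemma dominatedI: "n *\<^sub>R b - a \<in> P \<Longrightarrow> b \<in> P \<Longrightarrow> dominated C a b" for n :: real
proof -
  assume nP: "n *\<^sub>R b - a \<in> P" and b: "b \<in> P"
  have "(n *\<^sub>R b - a) + (real (nat \<lceil>n\<rceil>) - n) *\<^sub>R b \<in> P"
    using nP b by (intro P_add P_scaleR) (auto simp: real_nat_ceiling_ge)
  then have "real (nat \<lceil>n\<rceil>) *\<^sub>R b - a \<in> P" by (simp add: scaleR_diff_left)
  then show ?thesis unfolding dominated_def ..
qed

lemma dominated_refl: "a \<in> P \<Longrightarrow> dominated C a a"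
  by (rule dominatedI[of 1]) auto

lemma dominated_trans:
  assumes "dominated C a b" "dominated C b c"
  shows "dominated C a c"
proof -
  obtain n m :: nat where nm: "real n *\<^sub>R b - a \<in> P" "real m *\<^sub>R c - b \<in> P"
    using assms by (auto simp: dominated_def)
  then have "real n *\<^sub>R (real m *\<^sub>R c - b) + (real n *\<^sub>R b - a) \<in> P"
    by (intro P_add P_scaleR) auto
  then have "real (n * m) *\<^sub>R c - a \<in> P"
    by (simp add: scaleR_diff_right)
  then show ?thesis unfolding dominated_def ..
qed

lemma dominated_coz:
  assumes "dominated C a b" "a \<in> C" "b \<in> C"
  shows "coz C a \<subseteq> coz C b"
proof
  fix l assume l: "l \<in> coz C a"
  obtain n :: nat where "real n *\<^sub>R b - a \<in> P" using assms by (auto simp: dominated_def)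
  then have "Re (l (real n *\<^sub>R b - a)) \<ge> 0" using char_P_nonneg l by (simp add: coz_def)
  then have "Re (l a) \<le> real n * Re (l b)" using l assms by (simp add: coz_def)
  then have "real n * Re (l b) > 0" using l by (simp add: coz_def)
  then show "l \<in> coz C b" using l by (simp add: coz_def zero_less_mult_iff)
qed

lemma equiv_approx_rel: "equiv P (approx_rel C)"
proof (rule equivI)
  show "approx_rel C \<subseteq> P \<times> P" by (auto simp: approx_rel_def)
  show "refl_on P (approx_rel C)" by (auto simp: approx_rel_def refl_on_def dominated_refl)
  show "sym (approx_rel C)" by (auto simp: approx_rel_def sym_def)
  show "trans (approx_rel C)" unfolding approx_rel_def trans_def using dominated_trans by blast
qed

abbreviation cls :: "'a \<Rightarrow> 'a set" where "cls a \<equiv> approx_rel C `` {a}"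

lemma cls_eq_iff: "a \<in> P \<Longrightarrow> b \<in> P \<Longrightarrow> cls a = cls b \<longleftrightarrow> dominated C a b \<and> dominated C b a"
  using eq_equiv_class_iff[OF equiv_approx_rel, of a b] by (auto simp: approx_rel_def)

lemma carrier_L: "carrier (L_lattice C) = {cls a | a. a \<in> P}"
  by (auto simp: L_lattice_def quotient_def)

lemma le_L_iff:
  assumes "a \<in> P" "b \<in> P"
  shows "cls a \<sqsubseteq>\<^bsub>L_lattice C\<^esub> cls b \<longleftrightarrow> dominated C a b"
proof
  assume "cls a \<sqsubseteq>\<^bsub>L_lattice C\<^esub> cls b"
  then obtain a' b' where "dominated C a a'" "dominated C b' b" "dominated C a' b'"
    by (auto simp: L_lattice_def approx_rel_def)
  then show "dominated C a b" using dominated_trans by blast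
next
  assume "dominated C a b"
  moreover have "a \<in> cls a" "b \<in> cls b" using assms by (auto simp: approx_rel_def dominated_refl)
  ultimately show "cls a \<sqsubseteq>\<^bsub>L_lattice C\<^esub> cls b" by (auto simp: L_lattice_def)
qed

lemma partial_order_L: "partial_order (L_lattice C)"
proof (rule partial_orderI)
  fix x y assume "x \<in> carrier (L_lattice C)" "y \<in> carrier (L_lattice C)"
    "x \<sqsubseteq>\<^bsub>L_lattice C\<^esub> y" "y \<sqsubseteq>\<^bsub>L_lattice C\<^esub> x"
  then obtain a b where "a \<in> P" "x = cls a" "b \<in> P" "y = cls b" "dominated C a b" "dominated C b a"
    unfolding carrier_L using le_L_iff by blast
  then show "x = y" using cls_eq_iff by metis
next
  fix x y z assume "x \<in> carrier (L_lattice C)" "y \<in> carrier (L_lattice C)" "z \<in> carrier (L_lattice C)"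
    "x \<sqsubseteq>\<^bsub>L_lattice C\<^esub> y" "y \<sqsubseteq>\<^bsub>L_lattice C\<^esub> z"
  then obtain a b c where "a \<in> P" "x = cls a" "b \<in> P" "y = cls b" "c \<in> P" "z = cls c"
    "dominated C a b" "dominated C b c"
    unfolding carrier_L using le_L_iff by blast
  then show "x \<sqsubseteq>\<^bsub>L_lattice C\<^esub> z" using le_L_iff dominated_trans by metis
qed (auto simp: carrier_L le_L_iff dominated_refl L_lattice_def[THEN arg_cong[of _ _ eq]])

lemma dominated_add:
  assumes "dominated C a c" "dominated C b c"
  shows "dominated C (a + b) c"
proof -
  obtain n m :: nat where nm: "real n *\<^sub>R c - a \<in> P" "real m *\<^sub>R c - b \<in> P"
    using assms by (auto simp: dominated_def)
  then have "(real n *\<^sub>R c - a) + (real m *\<^sub>R c - b) \<in> P"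
    by (rule P_add)
  also have "(real n *\<^sub>R c - a) + (real m *\<^sub>R c - b) = real (n + m) *\<^sub>R c - (a + b)"
    by (simp add: algebra_simps)
  finally show ?thesis unfolding dominated_def ..
qed

text \<open>The sum replaces the pointwise maximum, to which it is equivalent up to a factor: bounds
  \<open>n c\<close> and \<open>m c\<close> of the summands add up to
  \<open>(n + m) c\<close>.\<close>

lemma join_L:
  assumes a: "a \<in> P" and b: "b \<in> P"
  shows "cls a \<squnion>\<^bsub>L_lattice C\<^esub> cls b = cls (a + b)"
proof -
  let ?L = "L_lattice C"
  have car: "cls a \<in> carrier ?L" "cls b \<in> carrier ?L" "cls (a + b) \<in> carrier ?L"
    using a b by (auto simp: carrier_L)
  have "dominated C a (a + b)" "dominated C b (a + b)"
    using a b dominatedI[of 1 "a + b" a] dominatedI[of 1 "a + b" b] by simp_all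
  then have up: "cls (a + b) \<in> Upper ?L {cls a, cls b}"
    using a b car by (auto simp: Upper_def le_L_iff)
  have "cls (a + b) \<sqsubseteq>\<^bsub>?L\<^esub> z" if "z \<in> Upper ?L {cls a, cls b}" for z
  proof -
    have "z \<in> carrier ?L" "cls a \<sqsubseteq>\<^bsub>?L\<^esub> z" "cls b \<sqsubseteq>\<^bsub>?L\<^esub> z"
      using that car by (auto simp: Upper_def)
    then obtain c where "c \<in> P" "z = cls c" "dominated C a c" "dominated C b c"
      using a b le_L_iff by (auto simp: carrier_L)
    then show ?thesis using dominated_add a b by (simp add: le_L_iff)
  qed
  then have "least ?L (cls (a + b)) (Upper ?L {cls a, cls b})"
    using up unfolding least_def Upper_def by auto
  then show ?thesis
    unfolding join_def sup_def
    using partial_order.least_unique[OF partial_order_L] by (intro some_equality)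
qed

lemma D_class_eq: "a \<in> P \<Longrightarrow> D_class C a = cls a"
  by (simp add: D_class_def positive_part_P)

subsection \<open>Regular ideals and open sets\<close>

text \<open>Equivalent elements have equal cozero sets, so the existential choice of a
  representative in \<open>ideal_of_open\<close> is immaterial.\<close>

lemma cls_in_ideal_of_open_iff:
  assumes "a \<in> P"
  shows "cls a \<in> ideal_of_open C W \<longleftrightarrow> coz C a \<subseteq> W"
proof
  assume "cls a \<in> ideal_of_open C W"
  then obtain b where b: "b \<in> P" "coz C b \<subseteq> W" "cls a = cls b"
    by (auto simp: ideal_of_open_def)
  then have "dominated C a b" using assms cls_eq_iff by simp
  then show "coz C a \<subseteq> W" using dominated_coz b(1,2) assms by (meson P_C subset_trans)
qed (use assms in \<open>auto simp: ideal_of_open_def\<close>)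

lemma coz_add: "a \<in> P \<Longrightarrow> b \<in> P \<Longrightarrow> coz C (a + b) \<subseteq> coz C a \<union> coz C b"
  by (auto simp: coz_def)

lemma coz_zero: "coz C 0 = {}"
  by (auto simp: coz_def)

text \<open>Regularity holds because a character positive at \<open>a\<close> exceeds some positive
  rational \<open>q\<close> there, hence lies in the cozero set of \<open>(a - q)^+\<close>, and
  \<open>a - q\<close> is way below \<open>a\<close> by reflexivity of the order.\<close>

lemma ideal_of_open_RIdl: "ideal_of_open C W \<in> RIdl C"
proof -
  let ?I = "ideal_of_open C W"
  have "lattice_ideal (L_lattice C) ?I"
    unfolding lattice_ideal_def
  proof (intro conjI ballI impI)
    show "?I \<subseteq> carrier (L_lattice C)" by (auto simp: ideal_of_open_def carrier_L)
    have "cls 0 \<in> ?I" by (simp add: cls_in_ideal_of_open_iff coz_zero)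
    then show "?I \<noteq> {}" by blast
  next
    fix x y assume "x \<in> ?I" "y \<in> carrier (L_lattice C)" "y \<sqsubseteq>\<^bsub>L_lattice C\<^esub> x"
    then obtain a b where ab: "a \<in> P" "x = cls a" "coz C a \<subseteq> W" "b \<in> P" "y = cls b" "dominated C b a"
      using le_L_iff by (auto simp: ideal_of_open_def carrier_L)
    then have "coz C b \<subseteq> W" using dominated_coz[of b a] by auto
    then show "y \<in> ?I" using ab by (simp add: cls_in_ideal_of_open_iff)
  next
    fix x y assume "x \<in> ?I" "y \<in> ?I"
    then obtain a b where "a \<in> P" "x = cls a" "coz C a \<subseteq> W" "b \<in> P" "y = cls b" "coz C b \<subseteq> W"
      by (auto simp: ideal_of_open_def)
    then show "x \<squnion>\<^bsub>L_lattice C\<^esub> y \<in> ?I"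
      using coz_add[of a b] by (auto simp: join_L cls_in_ideal_of_open_iff)
  qed
  moreover have "D_class C a \<in> ?I"
    if a: "a \<in> S" and below: "\<forall>b\<in>S. way_below C b a \<longrightarrow> D_class C b \<in> ?I" for a
    unfolding D_class_def cls_in_ideal_of_open_iff[OF positive_part(1)[OF a]]
  proof
    fix l assume "l \<in> coz C (positive_part C a)"
    then have l: "l \<in> X" "Re (l a) > 0"
      using positive_part(2)[OF a, of l] by (auto simp: coz_def)
    obtain q :: rat where q: "0 < real_of_rat q" "real_of_rat q < Re (l a)"
      using of_rat_dense[OF l(2)] by auto
    define b where "b = a - real_of_rat q *\<^sub>R 1"
    have b: "b \<in> S" using a by (simp add: b_def)
    have "D_class C b \<sqsubseteq>\<^bsub>L_lattice C\<^esub> D_class C b"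
      unfolding D_class_def using positive_part(1)[OF b] by (simp add: le_L_iff dominated_refl)
    then have "way_below C b a"
      unfolding way_below_def using q(1) by (auto simp: b_def zero_less_of_rat_iff intro!: exI[of _ q])
    with below b have "D_class C b \<in> ?I" by blast
    then have "coz C (positive_part C b) \<subseteq> W"
      unfolding D_class_def cls_in_ideal_of_open_iff[OF positive_part(1)[OF b]] .
    moreover have "l \<in> coz C (positive_part C b)"
      using positive_part(2)[OF b l(1)] l q a by (simp add: coz_def b_def)
    ultimately show "l \<in> W" by blast
  qed
  ultimately show ?thesis unfolding RIdl_def by blast
qed

lemma openin_open_of_ideal: "openin (gelfand_spectrum C) (open_of_ideal C I)"
  unfolding open_of_ideal_def by (intro openin_Union) (auto intro: openin_coz)

lemma open_of_ideal_of_open: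
  assumes "openin (gelfand_spectrum C) W"
  shows "open_of_ideal C (ideal_of_open C W) = W"
proof
  show "open_of_ideal C (ideal_of_open C W) \<subseteq> W"
    using cls_in_ideal_of_open_iff by (auto simp: open_of_ideal_def)
  show "W \<subseteq> open_of_ideal C (ideal_of_open C W)"
  proof
    fix l assume "l \<in> W"
    then obtain a where "a \<in> P" "l \<in> coz C a" "coz C a \<subseteq> W"
      using coz_basis[OF assms] by blast
    then show "l \<in> open_of_ideal C (ideal_of_open C W)"
      using cls_in_ideal_of_open_iff by (auto simp: open_of_ideal_def)
  qed
qed

lemma RIdl_subset: "I \<in> RIdl C \<Longrightarrow> I \<subseteq> carrier (L_lattice C)"
  by (simp add: RIdl_def lattice_ideal_def)

lemma RIdl_downward:
  assumes "I \<in> RIdl C" "cls b \<in> I" "dominated C a b" "a \<in> P" "b \<in> P"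
  shows "cls a \<in> I"
proof -
  have "cls a \<in> carrier (L_lattice C)" "cls a \<sqsubseteq>\<^bsub>L_lattice C\<^esub> cls b"
    using assms by (auto simp: carrier_L le_L_iff)
  then show ?thesis
    using assms(1,2) unfolding RIdl_def lattice_ideal_def by blast
qed

lemma RIdl_add:
  assumes "I \<in> RIdl C" "cls a \<in> I" "cls b \<in> I" "a \<in> P" "b \<in> P"
  shows "cls (a + b) \<in> I"
proof -
  have "cls a \<squnion>\<^bsub>L_lattice C\<^esub> cls b \<in> I"
    using assms(1-3) unfolding RIdl_def lattice_ideal_def by blast
  then show ?thesis using assms by (simp add: join_L)
qed

lemma RIdl_zero:
  assumes "I \<in> RIdl C"
  shows "cls 0 \<in> I"
proof -
  obtain x where "x \<in> I" "x \<in> carrier (L_lattice C)"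
    using assms RIdl_subset unfolding RIdl_def lattice_ideal_def by blast
  then obtain a where a: "a \<in> P" "cls a \<in> I" by (auto simp: carrier_L)
  have "dominated C 0 a" using a by (intro dominatedI[of 1]) auto
  then show ?thesis using RIdl_downward[OF assms a(2)] a by simp
qed

text \<open>An ideal is a lower set, so instead of every \<open>b\<close> with
  \<open>way_below C b a\<close> it suffices to test the truncations of \<open>a\<close>, which
  bound all such \<open>b\<close>.\<close>

lemma RIdl_regular:
  assumes "I \<in> RIdl C" "a \<in> P"
    and "\<And>r. r > 0 \<Longrightarrow> cls (positive_part C (a - r *\<^sub>R 1)) \<in> I"
  shows "cls a \<in> I"
proof -
  have "D_class C b \<in> I" if b: "b \<in> S" "way_below C b a" for b
  proof -
    obtain q :: rat where q: "q > 0"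
      "D_class C b \<sqsubseteq>\<^bsub>L_lattice C\<^esub> D_class C (a - of_rat q *\<^sub>R 1)"
      using b(2) by (auto simp: way_below_def)
    have aS: "a - of_rat q *\<^sub>R 1 \<in> S" using assms(2) by simp
    have "dominated C (positive_part C b) (positive_part C (a - of_rat q *\<^sub>R 1))"
      using q(2) unfolding D_class_def using positive_part(1)[OF b(1)] positive_part(1)[OF aS]
      by (simp add: le_L_iff)
    then show ?thesis
      unfolding D_class_def
      using RIdl_downward[OF assms(1) assms(3)[of "of_rat q"]] positive_part(1)[OF b(1)] positive_part(1)[OF aS] q(1)
      by simp
  qed
  then have below: "\<forall>b\<in>S. way_below C b a \<longrightarrow> D_class C b \<in> I"
    by (intro ballI impI)
  have "\<forall>a\<in>S. (\<forall>b\<in>S. way_below C b a \<longrightarrow> D_class C b \<in> I) \<longrightarrow> D_class C a \<in> I"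
    using assms(1) unfolding RIdl_def mem_Collect_eq by (rule conjunct2)
  from bspec[OF this P_S[OF assms(2)]] below have "D_class C a \<in> I"
    by (rule mp)
  then show ?thesis using assms(2) by (simp add: D_class_eq)
qed

text \<open>The sets \<open>{l. l c > l a - r}\<close>, where \<open>c\<close> ranges over the elements whose class lies in \<open>I\<close>, form
  a directed open cover of the spectrum, so that a single \<open>c\<close> suffices.\<close>

lemma ideal_of_open_of_ideal:
  assumes I: "I \<in> RIdl C"
  shows "ideal_of_open C (open_of_ideal C I) = I"
proof
  show "I \<subseteq> ideal_of_open C (open_of_ideal C I)"
  proof
    fix x assume x: "x \<in> I"
    then obtain a where "a \<in> P" "x = cls a" using RIdl_subset[OF I] by (auto simp: carrier_L)
    then show "x \<in> ideal_of_open C (open_of_ideal C I)"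
      using x by (auto simp: cls_in_ideal_of_open_iff open_of_ideal_def)
  qed
  show "ideal_of_open C (open_of_ideal C I) \<subseteq> I"
  proof
    fix x assume "x \<in> ideal_of_open C (open_of_ideal C I)"
    then obtain a where a: "a \<in> P" "x = cls a" "coz C a \<subseteq> open_of_ideal C I"
      by (auto simp: ideal_of_open_def)
    have "cls (positive_part C (a - r *\<^sub>R 1)) \<in> I" if r: "r > 0" for r
    proof -
      define U where "U c = coz C (c - (a - r *\<^sub>R 1))" for c
      define Q where "Q = {c \<in> P. cls c \<in> I}"
      have aS: "a - r *\<^sub>R 1 \<in> S" using a by simp
      have Re_U: "l \<in> U c \<longleftrightarrow> l \<in> X \<and> Re (l c) > Re (l a) - r" if "c \<in> P" for c l
        using that a(1) by (auto simp: U_def coz_def)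
      have "\<exists>c\<in>Q. l \<in> U c" if l: "l \<in> X" for l
      proof (cases "Re (l a) > 0")
        case True
        then have "l \<in> open_of_ideal C I" using a(3) l by (auto simp: coz_def)
        then obtain c where c: "c \<in> P" "cls c \<in> I" "Re (l c) > 0"
          by (auto simp: open_of_ideal_def coz_def)
        \<comment> \<open>The element \<open>c\<close> is merely positive at \<open>l\<close>; a
          large multiple, whose class is still in \<open>I\<close>, exceeds the value of
          \<open>a\<close>.\<close>
        obtain n :: nat where "Re (l a) < real n * Re (l c)"
          using ex_less_of_nat_mult[OF c(3)] by auto
        moreover have "dominated C (real n *\<^sub>R c) c"
          using c by (intro dominatedI[of n]) auto
        then have "cls (real n *\<^sub>R c) \<in> I"
          using RIdl_downward[OF I c(2)] c(1) by simp
        ultimately show ?thesis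
          using c(1) l r by (intro bexI[of _ "real n *\<^sub>R c"]) (auto simp: Re_U Q_def)
      next
        case False
        then show ?thesis
          using RIdl_zero[OF I] l r by (intro bexI[of _ 0]) (auto simp: Re_U Q_def)
      qed
      then have cover: "X \<subseteq> \<Union>(U ` Q)" by blast
      have "openin (gelfand_spectrum C) (U c)" if "c \<in> Q" for c
        unfolding U_def using that a(1) by (intro openin_coz) (auto simp: Q_def)
      then have "openin (gelfand_spectrum C) V" if "V \<in> U ` Q" for V
        using that by blast
      moreover have "compactin (gelfand_spectrum C) X"
        using compact_space_gelfand_spectrum by (simp add: compact_space_def)
      ultimately obtain \<F> where \<F>: "finite \<F>" "\<F> \<subseteq> U ` Q" "X \<subseteq> \<Union>\<F>"
        using compactinD[OF _ _ cover] by metis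
      obtain F where "F \<subseteq> Q" "finite F" "\<F> = U ` F"
        using finite_subset_image[OF \<F>(1,2)] by blast
      with \<F> have F: "finite F" "F \<subseteq> Q" "X \<subseteq> \<Union>(U ` F)"
        by simp_all
      \<comment> \<open>Being a sum of positive elements, \<open>c\<close> is at every character at
        least as large as each member of the finite subcover, and ideals are closed under such
        sums.\<close>
      define c where "c = sum (\<lambda>c. c) F"
      have FP: "d \<in> P" if "d \<in> F" for d using that F(2) by (auto simp: Q_def)
      have "c \<in> P \<and> cls c \<in> I"
        unfolding c_def using F(1,2)
      proof (induction F rule: finite_induct)
        case empty
        show ?case using RIdl_zero[OF I] by simp
      next
        case (insert d F)
        then show ?case using RIdl_add[OF I] by (simp add: Q_def)
      qed
      then have c: "c \<in> P" "cls c \<in> I" by auto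
      have "Re (l c) \<ge> max (Re (l (a - r *\<^sub>R 1))) 0" if l: "l \<in> X" for l
      proof -
        obtain d where d: "d \<in> F" "l \<in> U d" using F(3) l by blast
        have "l c = (\<Sum>d\<in>F. l d)"
          unfolding c_def using char_sum[OF F(1) l, of "\<lambda>c. c"] FP by simp
        then have "Re (l d) \<le> Re (l c)"
          using member_le_sum[OF d(1), of "\<lambda>d. Re (l d)"] char_P_nonneg[OF l FP] F(1) by simp
        then show ?thesis
          using d Re_U[OF FP[OF d(1)]] char_P_nonneg[OF l c(1)] l a(1) by simp
      qed
      \<comment> \<open>Here \<open>P_iff_char\<close> turns the pointwise bound into domination,
        with factor one.\<close>
      then have "c - positive_part C (a - r *\<^sub>R 1) \<in> P"
        using positive_part[OF aS] c(1) by (subst P_iff_char) auto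
      then have "dominated C (positive_part C (a - r *\<^sub>R 1)) c"
        using c(1) by (intro dominatedI[of 1]) auto
      then show ?thesis
        using RIdl_downward[OF I c(2)] c(1) positive_part(1)[OF aS] by blast
    qed
    then show "x \<in> I"
      unfolding a(2) by (rule RIdl_regular[OF I a(1)])
  qed
qed

end

section \<open>Frames and sheaves of opens\<close>

lemma (in partial_order) sup_eq_of_least: "least L s (Upper L A) \<Longrightarrow> \<Squnion>A = s"
  unfolding sup_def by (rule some_equality) (auto intro: least_unique)

lemma (in partial_order) inf_eq_of_greatest: "greatest L i (Lower L A) \<Longrightarrow> \<Sqinter>A = i"
  unfolding inf_def by (rule some_equality) (auto intro: greatest_unique)

lemma order_iso_bij: "order_iso L M f \<Longrightarrow> bij_betw f (carrier L) (carrier M)"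
  and order_iso_le: "order_iso L M f \<Longrightarrow> x \<in> carrier L \<Longrightarrow> y \<in> carrier L \<Longrightarrow> f x \<sqsubseteq>\<^bsub>M\<^esub> f y \<longleftrightarrow> x \<sqsubseteq>\<^bsub>L\<^esub> y"
  by (simp_all add: order_iso_def)

lemma order_iso_Upper:
  assumes f: "order_iso L M f" and A: "A \<subseteq> carrier L"
  shows "Upper M (f ` A) = f ` Upper L A"
proof -
  have img: "f ` carrier L = carrier M"
    using order_iso_bij[OF f] by (simp add: bij_betw_def)
  show ?thesis
  proof (intro equalityI subsetI)
    fix y assume y: "y \<in> Upper M (f ` A)"
    then have "y \<in> f ` carrier L" by (simp add: img Upper_def)
    then obtain x where x: "x \<in> carrier L" "y = f x" by blast
    have "a \<sqsubseteq>\<^bsub>L\<^esub> x" if "a \<in> A" for a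
      using y that x A img order_iso_le[OF f, of a x] by (auto simp: Upper_def)
    then show "y \<in> f ` Upper L A" using x by (auto simp: Upper_def)
  next
    fix y assume "y \<in> f ` Upper L A"
    then show "y \<in> Upper M (f ` A)"
      using A img order_iso_le[OF f] by (auto simp: Upper_def)
  qed
qed

lemma order_iso_least:
  assumes f: "order_iso L M f" and A: "A \<subseteq> carrier L" and s: "s \<in> carrier L"
  shows "least M (f s) (Upper M (f ` A)) \<longleftrightarrow> least L s (Upper L A)"
proof -
  have "Upper L A \<subseteq> carrier L" by (auto simp: Upper_def)
  moreover have "inj_on f (carrier L)" "f ` carrier L = carrier M"
    using order_iso_bij[OF f] by (auto simp: bij_betw_def)
  ultimately have "f s \<in> f ` Upper L A \<longleftrightarrow> s \<in> Upper L A" "f ` Upper L A \<subseteq> carrier M"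
    using s inj_on_image_mem_iff[of f "carrier L" s "Upper L A"] by blast+
  then show ?thesis
    unfolding least_def order_iso_Upper[OF f A]
    using order_iso_le[OF f s] \<open>Upper L A \<subseteq> carrier L\<close> by (simp add: subset_iff)
qed

lemma order_iso_dual: "order_iso L M f \<Longrightarrow> order_iso (inv_gorder L) (inv_gorder M) f"
  by (auto simp: order_iso_def)

lemma order_iso_greatest:
  assumes f: "order_iso L M f" and A: "A \<subseteq> carrier L" and s: "s \<in> carrier L"
  shows "greatest M (f s) (Lower M (f ` A)) \<longleftrightarrow> greatest L s (Lower L A)"
  using order_iso_least[OF order_iso_dual[OF f], of A s] A s by simp

text \<open>Suprema and binary meets are determined by the order, so \<open>f\<close> preserves them
  and the distributive law is pulled back by injectivity. This spares a direct computation of joins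
  of families of regular ideals.\<close>

lemma frame_order_iso:
  assumes f: "order_iso L M f" and L: "partial_order L" and M: "frame M"
  shows "frame L"
proof -
  interpret L: partial_order L by fact
  interpret M: frame M by fact
  have bij: "bij_betw f (carrier L) (carrier M)" by (rule order_iso_bij[OF f])
  then have img: "f ` carrier L = carrier M" and inj: "inj_on f (carrier L)"
    by (auto simp: bij_betw_def)
  have sup: "\<exists>s\<in>carrier L. least L s (Upper L A) \<and> f s = \<Squnion>\<^bsub>M\<^esub>(f ` A)" if A: "A \<subseteq> carrier L" for A
  proof -
    have fA: "f ` A \<subseteq> carrier M" using A img by auto
    then obtain t where t: "least M t (Upper M (f ` A))" using M.sup_exists by blast
    then have "t \<in> f ` carrier L" by (auto simp: img least_def Upper_def)
    then obtain s where s: "s \<in> carrier L" "t = f s" by blast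
    then show ?thesis
      using t order_iso_least[OF f A s(1)] M.sup_eq_of_least[OF t] by auto
  qed
  have inf: "\<exists>s\<in>carrier L. greatest L s (Lower L A) \<and> f s = \<Sqinter>\<^bsub>M\<^esub>(f ` A)" if A: "A \<subseteq> carrier L" for A
  proof -
    have fA: "f ` A \<subseteq> carrier M" using A img by auto
    then obtain t where t: "greatest M t (Lower M (f ` A))" using M.inf_exists by blast
    then have "t \<in> f ` carrier L" by (auto simp: img greatest_def Lower_def)
    then obtain s where s: "s \<in> carrier L" "t = f s" by blast
    then show ?thesis
      using t order_iso_greatest[OF f A s(1)] M.inf_eq_of_greatest[OF t] by auto
  qed
  have f_sup: "f (\<Squnion>\<^bsub>L\<^esub>A) = \<Squnion>\<^bsub>M\<^esub>(f ` A)" "\<Squnion>\<^bsub>L\<^esub>A \<in> carrier L" if "A \<subseteq> carrier L" for A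
    using sup[OF that] L.sup_eq_of_least by auto
  have f_meet: "f (x \<sqinter>\<^bsub>L\<^esub> y) = f x \<sqinter>\<^bsub>M\<^esub> f y" "x \<sqinter>\<^bsub>L\<^esub> y \<in> carrier L"
    if "x \<in> carrier L" "y \<in> carrier L" for x y
    using inf[of "{x, y}"] L.inf_eq_of_greatest that by (auto simp: meet_def)
  show "frame L"
  proof unfold_locales
    fix A assume "A \<subseteq> carrier L"
    then show "\<exists>s. least L s (Upper L A)" "\<exists>s. greatest L s (Lower L A)"
      using sup inf by blast+
  next
    fix x S assume x: "x \<in> carrier L" and S: "S \<subseteq> carrier L"
    have xS: "(\<lambda>s. x \<sqinter>\<^bsub>L\<^esub> s) ` S \<subseteq> carrier L" using x S f_meet by auto
    have "f (x \<sqinter>\<^bsub>L\<^esub> \<Squnion>\<^bsub>L\<^esub>S) = f x \<sqinter>\<^bsub>M\<^esub> \<Squnion>\<^bsub>M\<^esub>(f ` S)"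
      using x S f_sup f_meet by simp
    also have "\<dots> = \<Squnion>\<^bsub>M\<^esub>((\<lambda>s. f x \<sqinter>\<^bsub>M\<^esub> s) ` f ` S)"
      using x S img by (intro M.meet_sup_distrib) auto
    also have "(\<lambda>s. f x \<sqinter>\<^bsub>M\<^esub> s) ` f ` S = f ` (\<lambda>s. x \<sqinter>\<^bsub>L\<^esub> s) ` S"
      using x S f_meet by (force simp: image_image intro!: image_cong)
    also have "\<Squnion>\<^bsub>M\<^esub>(f ` (\<lambda>s. x \<sqinter>\<^bsub>L\<^esub> s) ` S) = f (\<Squnion>\<^bsub>L\<^esub>((\<lambda>s. x \<sqinter>\<^bsub>L\<^esub> s) ` S))"
      using f_sup[OF xS] by simp
    finally show "x \<sqinter>\<^bsub>L\<^esub> \<Squnion>\<^bsub>L\<^esub>S = \<Squnion>\<^bsub>L\<^esub>((\<lambda>s. x \<sqinter>\<^bsub>L\<^esub> s) ` S)"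
      by (rule inj_onD[OF inj]) (use x S xS f_sup f_meet in simp_all)
  qed
qed

lemma frame_opens_frame: "frame (opens_frame Y)"
proof -
  let ?L = "opens_frame Y"
  interpret partial_order ?L
    by (rule partial_orderI) (auto simp: opens_frame_def)
  have car: "carrier ?L = {V. openin Y V}" and le: "x \<sqsubseteq>\<^bsub>?L\<^esub> y \<longleftrightarrow> x \<subseteq> y" for x y
    by (simp_all add: opens_frame_def)
  have sup: "least ?L (\<Union>A) (Upper ?L A)" if "A \<subseteq> carrier ?L" for A
    using that by (auto simp: least_def Upper_def car le)
  \<comment> \<open>The infimum is the interior of the intersection, written as a union of open sets
    so that the empty family is covered as well.\<close>
  have inf: "greatest ?L (\<Union>{V. openin Y V \<and> (\<forall>a\<in>A. V \<subseteq> a)}) (Lower ?L A)" if "A \<subseteq> carrier ?L" for A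
    using that unfolding greatest_def Lower_def car le by auto
  have meet: "greatest ?L (x \<inter> y) (Lower ?L {x, y})" if "x \<in> carrier ?L" "y \<in> carrier ?L" for x y
    using that by (auto simp: greatest_def Lower_def car le)
  note sup_eq = sup_eq_of_least[OF sup]
  have meet_eq: "x \<sqinter>\<^bsub>?L\<^esub> y = x \<inter> y" if "x \<in> carrier ?L" "y \<in> carrier ?L" for x y
    unfolding meet_def by (rule inf_eq_of_greatest[OF meet[OF that]])
  show ?thesis
  proof unfold_locales
    fix A assume "A \<subseteq> carrier ?L"
    then show "\<exists>s. least ?L s (Upper ?L A)" "\<exists>s. greatest ?L s (Lower ?L A)"
      using sup inf by blast+
  next
    fix x S assume x: "x \<in> carrier ?L" and S: "S \<subseteq> carrier ?L"
    have U: "\<Union>S \<in> carrier ?L" using S by (auto simp: car)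
    have "(\<lambda>s. x \<sqinter>\<^bsub>?L\<^esub> s) ` S = (\<lambda>s. x \<inter> s) ` S"
      using x S meet_eq by (intro image_cong) auto
    moreover have "(\<lambda>s. x \<inter> s) ` S \<subseteq> carrier ?L"
      using x S by (auto simp: car)
    ultimately show "x \<sqinter>\<^bsub>?L\<^esub> \<Squnion>\<^bsub>?L\<^esub>S = \<Squnion>\<^bsub>?L\<^esub>((\<lambda>s. x \<sqinter>\<^bsub>?L\<^esub> s) ` S)"
      using sup_eq S meet_eq[OF x U] by auto
  qed
qed

lemma poset_sheaf_sheaf_of_map:
  assumes p: "continuous_map Y X p"
  shows "poset_sheaf X (sheaf_of_map Y p)"
proof -
  let ?F = "sheaf_of_map Y p"
  have car: "carrier (sections ?F U) = {V. openin Y V \<and> V \<subseteq> p -` U}"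
    and le: "s \<sqsubseteq>\<^bsub>sections ?F U\<^esub> t \<longleftrightarrow> s \<subseteq> t"
    and restr: "restr ?F U V s = s \<inter> p -` V" for U V s t
    by (simp_all add: sheaf_of_map_def)
  have open_restr: "openin Y (s \<inter> p -` V)" if "openin X V" "openin Y s" for s V
  proof -
    \<comment> \<open>The preimage in the whole type need not be open; intersecting with
      \<open>s\<close> confines it to the space.\<close>
    have "s \<inter> p -` V = s \<inter> {y \<in> topspace Y. p y \<in> V}"
      using openin_subset[OF that(2)] by auto
    then show ?thesis
      using that openin_continuous_map_preimage[OF p] by auto
  qed
  show ?thesis
  proof (rule poset_sheaf.intro)
    fix U
    show "partial_order (sections ?F U)"
      by (rule partial_orderI) (auto simp: sheaf_of_map_def)
  next
    fix \<V> \<sigma>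
    assume \<V>: "\<And>V. V \<in> \<V> \<Longrightarrow> openin X V" and \<sigma>: "\<And>V. V \<in> \<V> \<Longrightarrow> \<sigma> V \<in> carrier (sections ?F V)"
      and comp: "\<And>V W. V \<in> \<V> \<Longrightarrow> W \<in> \<V> \<Longrightarrow> restr ?F V (V \<inter> W) (\<sigma> V) = restr ?F W (V \<inter> W) (\<sigma> W)"
    show "\<exists>!t. t \<in> carrier (sections ?F (\<Union>\<V>)) \<and> (\<forall>V\<in>\<V>. restr ?F (\<Union>\<V>) V t = \<sigma> V)"
    proof (rule ex1I[of _ "\<Union>(\<sigma> ` \<V>)"])
      have "\<Union>(\<sigma> ` \<V>) \<inter> p -` V = \<sigma> V" if V: "V \<in> \<V>" for V
      proof (intro equalityI subsetI)
        fix x assume "x \<in> \<Union>(\<sigma> ` \<V>) \<inter> p -` V"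
        then obtain W where W: "W \<in> \<V>" "x \<in> \<sigma> W" "p x \<in> V" by auto
        then have "p x \<in> W" using \<sigma>[of W] by (auto simp: car)
        then have "x \<in> \<sigma> W \<inter> p -` (V \<inter> W)" using W by auto
        then show "x \<in> \<sigma> V" using comp[OF V W(1)] by (auto simp: restr)
      next
        fix x assume "x \<in> \<sigma> V"
        then show "x \<in> \<Union>(\<sigma> ` \<V>) \<inter> p -` V" using \<sigma>[OF V] V by (auto simp: car)
      qed
      moreover have "\<Union>(\<sigma> ` \<V>) \<in> carrier (sections ?F (\<Union>\<V>))"
        using \<sigma> by (auto simp: car intro!: openin_Union)
      ultimately show "\<Union>(\<sigma> ` \<V>) \<in> carrier (sections ?F (\<Union>\<V>)) \<and>
          (\<forall>V\<in>\<V>. restr ?F (\<Union>\<V>) V (\<Union>(\<sigma> ` \<V>)) = \<sigma> V)"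
        by (auto simp: restr)
    next
      fix t assume t: "t \<in> carrier (sections ?F (\<Union>\<V>)) \<and> (\<forall>V\<in>\<V>. restr ?F (\<Union>\<V>) V t = \<sigma> V)"
      then have "t \<subseteq> p -` \<Union>\<V>" by (simp add: car)
      then have "t = t \<inter> p -` \<Union>\<V>" by (rule Int_absorb2[symmetric])
      also have "\<dots> = (\<Union>V\<in>\<V>. t \<inter> p -` V)" by (simp only: vimage_Union Int_UN_distrib)
      also have "\<dots> = (\<Union>V\<in>\<V>. \<sigma> V)"
        using t unfolding restr by (intro SUP_cong refl) blast
      finally show "t = \<Union>(\<sigma> ` \<V>)" .
    qed
  next
    fix \<V> s t
    assume "s \<in> carrier (sections ?F (\<Union>\<V>))"
      and le_V: "\<And>V. V \<in> \<V> \<Longrightarrow> restr ?F (\<Union>\<V>) V s \<sqsubseteq>\<^bsub>sections ?F V\<^esub> restr ?F (\<Union>\<V>) V t"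
    then show "s \<sqsubseteq>\<^bsub>sections ?F (\<Union>\<V>)\<^esub> t"
      by (fastforce simp: car le restr)
  qed (auto simp: car le restr open_restr)
qed

section \<open>The internal spectrum\<close>

lemma comm_cstar_of_contexts: "C \<in> contexts A \<Longrightarrow> comm_cstar C"
  by (simp add: contexts_def comm_cstar_def)

lemma positive_cone_mono: "C \<subseteq> D \<Longrightarrow> positive_cone C \<subseteq> positive_cone D"
  unfolding positive_cone_def by blast

lemma approx_rel_mono: "C \<subseteq> D \<Longrightarrow> approx_rel C \<subseteq> approx_rel D"
  using positive_cone_mono[of C D] unfolding approx_rel_def dominated_def by blast

lemma L_map_class:
  assumes D: "comm_cstar D" and CD: "C \<subseteq> D" and C: "comm_cstar C" and a: "a \<in> positive_cone C"
  shows "L_map D (approx_rel C `` {a}) = approx_rel D `` {a}"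
proof -
  have tr: "trans (approx_rel D)"
    using comm_cstar.equiv_approx_rel[OF D] by (simp add: equiv_def)
  have "(a, a) \<in> approx_rel C"
    using comm_cstar.equiv_approx_rel[OF C] a by (simp add: equiv_def refl_on_def)
  then show ?thesis
    unfolding L_map_def using approx_rel_mono[OF CD] transD[OF tr] by blast
qed

lemma restrict_character:
  assumes C: "comm_cstar C" and CD: "C \<subseteq> D" and l: "l \<in> characters D"
  shows "restrict l C \<in> characters C"
proof -
  interpret C: comm_cstar C by fact
  have "x \<in> D" if "x \<in> C" for x using CD that by blast
  then show ?thesis
    using l unfolding characters_def by simp
qed

lemma topspace_Sigma_space: "topspace (Sigma_space A) = Sigma (contexts A) characters"
proof -
  have "is_open_in_Sigma A (Sigma (contexts A) characters)"
    unfolding is_open_in_Sigma_def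
  proof (intro conjI ballI impI allI)
    fix C assume C: "C \<in> contexts A"
    then have "{l. (C, l) \<in> Sigma (contexts A) characters} = topspace (gelfand_spectrum C)"
      using comm_cstar.topspace_gelfand_spectrum[OF comm_cstar_of_contexts] by auto
    then show "openin (gelfand_spectrum C) {l. (C, l) \<in> Sigma (contexts A) characters}"
      by simp
  qed auto
  then show ?thesis
    unfolding topspace_def openin_Sigma_space by (auto simp: is_open_in_Sigma_def)
qed

lemma continuous_map_Sigma_fst: "continuous_map (Sigma_space A) (alexandrov (contexts A)) fst"
  unfolding continuous_map_def topspace_Sigma_space topspace_alexandrov
proof (intro conjI allI impI)
  fix U assume "openin (alexandrov (contexts A)) U"
  then have U: "U \<subseteq> contexts A" "\<And>C D. C \<in> U \<Longrightarrow> D \<in> contexts A \<Longrightarrow> C \<subseteq> D \<Longrightarrow> D \<in> U"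
    by (auto simp: openin_alexandrov)
  let ?W = "{x \<in> Sigma (contexts A) characters. fst x \<in> U}"
  show "openin (Sigma_space A) ?W"
    unfolding openin_Sigma_space is_open_in_Sigma_def
  proof (intro conjI ballI impI allI)
    fix C assume C: "C \<in> contexts A"
    then have "{l. (C, l) \<in> ?W} = (if C \<in> U then topspace (gelfand_spectrum C) else {})"
      using comm_cstar.topspace_gelfand_spectrum[OF comm_cstar_of_contexts] by auto
    then show "openin (gelfand_spectrum C) {l. (C, l) \<in> ?W}"
      by simp
  qed (use U in auto)
qed auto

section \<open>Passage between families of regular ideals and open sets of the total space\<close>

definition total_open :: "'a::unital_cstar_algebra set set \<Rightarrow> ('a set \<Rightarrow> 'a set set) \<Rightarrow> ('a set \<times> ('a \<Rightarrow> complex)) set" where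
  "total_open U F = (SIGMA C:U. open_of_ideal C (F C))"

definition ideal_family :: "'a::unital_cstar_algebra set set \<Rightarrow> ('a set \<times> ('a \<Rightarrow> complex)) set \<Rightarrow> 'a set \<Rightarrow> 'a set set" where
  "ideal_family U W = (\<lambda>C\<in>U. ideal_of_open C {l. (C, l) \<in> W})"

lemma carrier_internal_spectrum:
  "carrier (sections (internal_spectrum A) U) = {F \<in> subsheaves_of_L U. \<forall>C\<in>U. F C \<in> RIdl C}"
  and le_internal_spectrum: "F \<sqsubseteq>\<^bsub>sections (internal_spectrum A) U\<^esub> G \<longleftrightarrow> (\<forall>C\<in>U. F C \<subseteq> G C)"
  and restr_internal_spectrum: "restr (internal_spectrum A) U V F = restrict F V"
  by (simp_all add: internal_spectrum_def)

lemma internal_section_iff: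
  assumes "U \<subseteq> contexts A"
  shows "F \<in> carrier (sections (internal_spectrum A) U) \<longleftrightarrow>
    F \<in> extensional U \<and> (\<forall>C\<in>U. F C \<in> RIdl C) \<and> (\<forall>C\<in>U. \<forall>D\<in>U. C \<subseteq> D \<longrightarrow> L_map D ` F C \<subseteq> F D)"
proof -
  have "F C \<subseteq> carrier (L_lattice C)" if "C \<in> U" "F C \<in> RIdl C" for C
    using that assms comm_cstar.RIdl_subset[OF comm_cstar_of_contexts] by blast
  then have "(\<forall>C\<in>U. F C \<in> RIdl C) \<Longrightarrow> F \<in> (\<Pi> C\<in>U. Pow (carrier (L_lattice C)))"
    by simp
  then show ?thesis
    unfolding carrier_internal_spectrum subsheaves_of_L_def PiE_def mem_Collect_eq Int_iff by blast
qed

text \<open>Families are glued pointwise. Stability along \<open>C \<subseteq> D\<close>, which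
  involves two contexts at once, can be checked inside one member of the cover: open sets are upward
  closed, so a member containing \<open>C\<close> contains \<open>D\<close>.\<close>

lemma poset_sheaf_internal_spectrum:
  fixes A :: "'a::unital_cstar_algebra itself"
  shows "poset_sheaf (alexandrov (contexts A)) (internal_spectrum A)"
proof -
  let ?F = "internal_spectrum A" and ?X = "alexandrov (contexts A)"
  have sub: "U \<subseteq> contexts A" if "openin ?X U" for U
    using that by (simp add: openin_alexandrov)
  have up: "D \<in> U" if "openin ?X U" "C \<in> U" "D \<in> contexts A" "C \<subseteq> D" for U C D
    using that by (auto simp: openin_alexandrov)
  note iff = internal_section_iff[OF sub]
  show ?thesis
  proof (rule poset_sheaf.intro)
    fix U assume U: "openin ?X U"
    show "partial_order (sections ?F U)"
    proof (rule partial_orderI)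
      fix F G assume "F \<in> carrier (sections ?F U)" "G \<in> carrier (sections ?F U)"
        "F \<sqsubseteq>\<^bsub>sections ?F U\<^esub> G" "G \<sqsubseteq>\<^bsub>sections ?F U\<^esub> F"
      then show "F = G"
        unfolding iff[OF U] le_internal_spectrum by (intro extensionalityI[of F U G]) auto
    next
      show "eq (sections ?F U) = (=)" by (simp add: internal_spectrum_def)
    qed (fastforce simp: le_internal_spectrum)+
  next
    fix U V F
    assume U: "openin ?X U" and V: "openin ?X V" "V \<subseteq> U" and F: "F \<in> carrier (sections ?F U)"
    have "F C \<in> RIdl C \<and> (\<forall>D\<in>V. C \<subseteq> D \<longrightarrow> L_map D ` F C \<subseteq> F D)" if "C \<in> V" for C
      using F that V(2) unfolding iff[OF U] by blast
    then show "restr ?F U V F \<in> carrier (sections ?F V)"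
      unfolding iff[OF V(1)] restr_internal_spectrum by simp
  next
    fix U F assume "openin ?X U" "F \<in> carrier (sections ?F U)"
    then show "restr ?F U U F = F"
      by (simp add: iff restr_internal_spectrum extensional_restrict)
  next
    fix \<V> \<sigma>
    assume \<V>: "\<And>V. V \<in> \<V> \<Longrightarrow> openin ?X V" and \<sigma>: "\<And>V. V \<in> \<V> \<Longrightarrow> \<sigma> V \<in> carrier (sections ?F V)"
      and comp: "\<And>V W. V \<in> \<V> \<Longrightarrow> W \<in> \<V> \<Longrightarrow> restr ?F V (V \<inter> W) (\<sigma> V) = restr ?F W (V \<inter> W) (\<sigma> W)"
    have U: "openin ?X (\<Union>\<V>)" using \<V> by (rule openin_Union)
    define t where "t = (\<lambda>C\<in>\<Union>\<V>. \<sigma> (SOME V. V \<in> \<V> \<and> C \<in> V) C)"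
    have t: "t C = \<sigma> V C" if "V \<in> \<V>" "C \<in> V" for V C
    proof -
      let ?W = "SOME V. V \<in> \<V> \<and> C \<in> V"
      have W: "?W \<in> \<V> \<and> C \<in> ?W" by (rule someI[of _ V]) (use that in auto)
      have "restrict (\<sigma> V) (V \<inter> ?W) C = restrict (\<sigma> ?W) (V \<inter> ?W) C"
        using comp[of V ?W] that W by (simp add: restr_internal_spectrum)
      then show ?thesis using that W by (auto simp: t_def)
    qed
    show "\<exists>!t. t \<in> carrier (sections ?F (\<Union>\<V>)) \<and> (\<forall>V\<in>\<V>. restr ?F (\<Union>\<V>) V t = \<sigma> V)"
    proof (rule ex1I[of _ t])
      have "t \<in> carrier (sections ?F (\<Union>\<V>))"
        unfolding iff[OF U]
      proof (intro conjI ballI impI)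
        show "t \<in> extensional (\<Union>\<V>)" by (simp add: t_def)
      next
        fix C assume "C \<in> \<Union>\<V>"
        then obtain V where V: "V \<in> \<V>" "C \<in> V" by blast
        then show "t C \<in> RIdl C" using \<sigma>[OF V(1)] t[OF V] by (simp add: iff[OF \<V>])
      next
        fix C D assume "C \<in> \<Union>\<V>" and D: "D \<in> \<Union>\<V>" "C \<subseteq> D"
        then obtain V where V: "V \<in> \<V>" "C \<in> V" by blast
        have DV: "D \<in> V" using up[OF \<V>[OF V(1)] V(2)] D sub[OF U] by blast
        then show "L_map D ` t C \<subseteq> t D"
          using \<sigma>[OF V(1)] t[OF V] t[OF V(1) DV] V(2) D(2) unfolding iff[OF \<V>[OF V(1)]] by simp
      qed
      moreover have "restrict t V = \<sigma> V" if V: "V \<in> \<V>" for V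
        using \<sigma>[OF V] t[OF V] by (intro extensionalityI[of _ V]) (auto simp: iff[OF \<V>[OF V]])
      ultimately show "t \<in> carrier (sections ?F (\<Union>\<V>)) \<and> (\<forall>V\<in>\<V>. restr ?F (\<Union>\<V>) V t = \<sigma> V)"
        by (simp add: restr_internal_spectrum)
    next
      fix t' assume t': "t' \<in> carrier (sections ?F (\<Union>\<V>)) \<and> (\<forall>V\<in>\<V>. restr ?F (\<Union>\<V>) V t' = \<sigma> V)"
      show "t' = t"
      proof (rule extensionalityI[of _ "\<Union>\<V>"])
        show "t' \<in> extensional (\<Union>\<V>)" using t' iff[OF U] by simp
        show "t \<in> extensional (\<Union>\<V>)" by (simp add: t_def)
        fix C assume "C \<in> \<Union>\<V>"
        then obtain V where V: "V \<in> \<V>" "C \<in> V" by blast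
        then have "restrict t' V = \<sigma> V" using t' by (simp add: restr_internal_spectrum)
        then have "t' C = \<sigma> V C" using V(2) by (metis restrict_apply')
        then show "t' C = t C" using t[OF V] by simp
      qed
    qed
  next
    fix \<V> F G
    assume "\<And>V. V \<in> \<V> \<Longrightarrow> restr ?F (\<Union>\<V>) V F \<sqsubseteq>\<^bsub>sections ?F V\<^esub> restr ?F (\<Union>\<V>) V G"
    then show "F \<sqsubseteq>\<^bsub>sections ?F (\<Union>\<V>)\<^esub> G"
      by (auto simp: le_internal_spectrum restr_internal_spectrum)
  qed (auto simp: le_internal_spectrum restr_internal_spectrum Int_absorb1 inf_absorb2)
qed

text \<open>An element \<open>a\<close> witnessing that the restriction of \<open>l'\<close> to
  \<open>C\<close> belongs to the set also serves for \<open>l'\<close> over \<open>D\<close>: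
  restriction does not change the value at \<open>a\<close>, and stability of \<open>F\<close>
  carries the class of \<open>a\<close> into \<open>F D\<close>.\<close>

lemma total_open_open:
  assumes U: "openin (alexandrov (contexts A)) U"
    and F: "F \<in> carrier (sections (internal_spectrum A) U)"
  shows "openin (Sigma_space A) (total_open U F)"
  unfolding openin_Sigma_space is_open_in_Sigma_def
proof (intro conjI ballI impI allI)
  have sub: "U \<subseteq> contexts A" using U by (simp add: openin_alexandrov)
  have F': "F C \<in> RIdl C" "\<And>D. D \<in> U \<Longrightarrow> C \<subseteq> D \<Longrightarrow> L_map D ` F C \<subseteq> F D" if "C \<in> U" for C
    using F that unfolding internal_section_iff[OF sub] by auto
  show "total_open U F \<subseteq> Sigma (contexts A) characters"
    using sub by (auto simp: total_open_def open_of_ideal_def coz_def)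
  fix C assume C: "C \<in> contexts A"
  have "{l. (C, l) \<in> total_open U F} = (if C \<in> U then open_of_ideal C (F C) else {})"
    by (auto simp: total_open_def)
  then show "openin (gelfand_spectrum C) {l. (C, l) \<in> total_open U F}"
    using comm_cstar.openin_open_of_ideal[OF comm_cstar_of_contexts[OF C]] by simp
  fix D l l'
  assume D: "D \<in> contexts A" "C \<subseteq> D" and "(C, l) \<in> total_open U F \<and> l' \<in> characters D \<and> restrict l' C = l"
  then have CU: "C \<in> U" and l: "restrict l' C \<in> open_of_ideal C (F C)" and l': "l' \<in> characters D"
    by (auto simp: total_open_def)
  have DU: "D \<in> U" using U CU D by (auto simp: openin_alexandrov)
  obtain a where a: "a \<in> positive_cone C" "approx_rel C `` {a} \<in> F C" "restrict l' C \<in> coz C a"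
    using l by (auto simp: open_of_ideal_def)
  have "a \<in> C" using comm_cstar.P_C[OF comm_cstar_of_contexts[OF C]] a(1) by blast
  then have "l' \<in> coz D a" using a(3) l' by (simp add: coz_def)
  moreover have "approx_rel D `` {a} \<in> F D"
    using L_map_class[OF comm_cstar_of_contexts[OF D(1)] D(2) comm_cstar_of_contexts[OF C] a(1)]
      F'(2)[OF CU DU D(2)] a(2) by blast
  moreover have "a \<in> positive_cone D" using positive_cone_mono[OF D(2)] a(1) by blast
  ultimately show "(D, l') \<in> total_open U F"
    using DU by (auto simp: total_open_def open_of_ideal_def)
qed

text \<open>Stability follows by restricting and lifting: a character in \<open>coz D a\<close>
  restricts to one in \<open>coz C a\<close>, which lies over \<open>C\<close> in \<open>W\<close>,
  and openness of \<open>W\<close> returns the original character over \<open>D\<close>.\<close>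

lemma ideal_family_section:
  assumes U: "openin (alexandrov (contexts A)) U" and W: "openin (Sigma_space A) W"
  shows "ideal_family U W \<in> carrier (sections (internal_spectrum A) U)"
proof -
  have sub: "U \<subseteq> contexts A" using U by (simp add: openin_alexandrov)
  show ?thesis
    unfolding internal_section_iff[OF sub]
  proof (intro conjI ballI impI)
    show "ideal_family U W \<in> extensional U" by (simp add: ideal_family_def)
  next
    fix C assume C: "C \<in> U"
    then show "ideal_family U W C \<in> RIdl C"
      using comm_cstar.ideal_of_open_RIdl[OF comm_cstar_of_contexts] sub by (auto simp: ideal_family_def)
  next
    fix C D assume CU: "C \<in> U" and DU: "D \<in> U" and CD: "C \<subseteq> D"
    have C: "comm_cstar C" and D: "comm_cstar D"
      using CU DU sub comm_cstar_of_contexts by blast+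
    show "L_map D ` ideal_family U W C \<subseteq> ideal_family U W D"
    proof
      fix y assume "y \<in> L_map D ` ideal_family U W C"
      then obtain a where a: "a \<in> positive_cone C" "coz C a \<subseteq> {l. (C, l) \<in> W}" "y = L_map D (approx_rel C `` {a})"
        using CU by (auto simp: ideal_family_def ideal_of_open_def)
      have aC: "a \<in> C" using comm_cstar.P_C[OF C a(1)] .
      have "(D, l) \<in> W" if "l \<in> coz D a" for l
      proof (rule is_open_in_SigmaD)
        show "is_open_in_Sigma A W" using W by (simp add: openin_Sigma_space)
        have l: "l \<in> characters D" "Re (l a) > 0" using that by (auto simp: coz_def)
        then show "l \<in> characters D" by simp
        have "restrict l C \<in> coz C a"
          using restrict_character[OF C CD l(1)] l(2) aC by (simp add: coz_def)
        then show "(C, restrict l C) \<in> W" using a(2) by blast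
      qed (use CU DU sub CD in auto)
      then have "approx_rel D `` {a} \<in> ideal_of_open D {l. (D, l) \<in> W}"
        using positive_cone_mono[OF CD] a(1) by (auto simp: ideal_of_open_def)
      then show "y \<in> ideal_family U W D"
        using a(3) L_map_class[OF D CD C a(1)] DU by (simp add: ideal_family_def)
    qed
  qed
qed

lemma ideal_family_total_open:
  assumes U: "openin (alexandrov (contexts A)) U"
    and F: "F \<in> carrier (sections (internal_spectrum A) U)"
  shows "ideal_family U (total_open U F) = F"
proof (rule extensionalityI[of _ U])
  have sub: "U \<subseteq> contexts A" using U by (simp add: openin_alexandrov)
  note F' = F[unfolded internal_section_iff[OF sub]]
  show "F \<in> extensional U" using F' by simp
  show "ideal_family U (total_open U F) \<in> extensional U" by (simp add: ideal_family_def)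
  fix C assume C: "C \<in> U"
  then have "{l. (C, l) \<in> total_open U F} = open_of_ideal C (F C)"
    by (auto simp: total_open_def)
  then show "ideal_family U (total_open U F) C = F C"
    using comm_cstar.ideal_of_open_of_ideal[OF comm_cstar_of_contexts, of C A "F C"] C F' sub
    by (auto simp: ideal_family_def)
qed

lemma total_open_ideal_family:
  assumes "openin (alexandrov (contexts A)) U" "openin (Sigma_space A) W" "W \<subseteq> fst -` U"
  shows "total_open U (ideal_family U W) = W"
proof -
  have W: "W \<subseteq> Sigma (contexts A) characters"
    "\<And>C. C \<in> contexts A \<Longrightarrow> openin (gelfand_spectrum C) {l. (C, l) \<in> W}"
    using assms(2) unfolding openin_Sigma_space is_open_in_Sigma_def by blast+
  have eq: "open_of_ideal C (ideal_of_open C {l. (C, l) \<in> W}) = {l. (C, l) \<in> W}" if "C \<in> contexts A" for C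
    by (rule comm_cstar.open_of_ideal_of_open[OF comm_cstar_of_contexts[OF that] W(2)[OF that]])
  have sub: "U \<subseteq> contexts A" using assms(1) by (simp add: openin_alexandrov)
  have "total_open U (ideal_family U W) = (SIGMA C:U. {l. (C, l) \<in> W})"
    unfolding total_open_def ideal_family_def using eq sub by (intro Sigma_cong) auto
  also have "\<dots> = W" using assms(3) by auto
  finally show ?thesis .
qed

lemma ideal_of_open_mono: "W \<subseteq> W' \<Longrightarrow> ideal_of_open C W \<subseteq> ideal_of_open C W'"
  unfolding ideal_of_open_def by fast

text \<open>The order is reflected because the inverse \<open>ideal_family\<close> is monotone
  too.\<close>

lemma total_open_mono_iff:
  assumes U: "openin (alexandrov (contexts A)) U"
    and F: "F \<in> carrier (sections (internal_spectrum A) U)"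
    and G: "G \<in> carrier (sections (internal_spectrum A) U)"
  shows "(\<forall>C\<in>U. F C \<subseteq> G C) \<longleftrightarrow> total_open U F \<subseteq> total_open U G"
proof
  show "total_open U F \<subseteq> total_open U G" if "\<forall>C\<in>U. F C \<subseteq> G C"
    using that unfolding total_open_def open_of_ideal_def by fast
  show "\<forall>C\<in>U. F C \<subseteq> G C" if sub: "total_open U F \<subseteq> total_open U G"
  proof
    fix C assume C: "C \<in> U"
    have "{l. (C, l) \<in> total_open U F} \<subseteq> {l. (C, l) \<in> total_open U G}"
      using sub by blast
    then have "ideal_family U (total_open U F) C \<subseteq> ideal_family U (total_open U G) C"
      using C by (simp add: ideal_family_def ideal_of_open_mono)
    then show "F C \<subseteq> G C"
      unfolding ideal_family_total_open[OF U F] ideal_family_total_open[OF U G] .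
  qed
qed

lemma order_iso_total_open:
  assumes U: "openin (alexandrov (contexts A)) U"
  shows "order_iso (sections (internal_spectrum A) U) (sections (sheaf_of_map (Sigma_space A) fst) U) (total_open U)"
proof -
  have car: "carrier (sections (sheaf_of_map (Sigma_space A) fst) U) = {W. openin (Sigma_space A) W \<and> W \<subseteq> fst -` U}"
    and le: "W \<sqsubseteq>\<^bsub>sections (sheaf_of_map (Sigma_space A) fst) U\<^esub> W' \<longleftrightarrow> W \<subseteq> W'" for W W'
    by (simp_all add: sheaf_of_map_def)
  have fst: "total_open U F \<subseteq> fst -` U" for F
    by (auto simp: total_open_def)
  show ?thesis
    unfolding order_iso_def le le_internal_spectrum
  proof (intro conjI ballI)
    show "bij_betw (total_open U) (carrier (sections (internal_spectrum A) U))
        (carrier (sections (sheaf_of_map (Sigma_space A) fst) U))"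
    proof (rule bij_betw_byWitness[where f' = "ideal_family U"])
      show "\<forall>F\<in>carrier (sections (internal_spectrum A) U). ideal_family U (total_open U F) = F"
        using ideal_family_total_open[OF U] by blast
      show "\<forall>W\<in>carrier (sections (sheaf_of_map (Sigma_space A) fst) U). total_open U (ideal_family U W) = W"
        using total_open_ideal_family[OF U] unfolding car by blast
      show "total_open U ` carrier (sections (internal_spectrum A) U)
          \<subseteq> carrier (sections (sheaf_of_map (Sigma_space A) fst) U)"
        using total_open_open[OF U] fst unfolding car by blast
      show "ideal_family U ` carrier (sections (sheaf_of_map (Sigma_space A) fst) U)
          \<subseteq> carrier (sections (internal_spectrum A) U)"
        using ideal_family_section[OF U] unfolding car by blast
    qed
  qed (rule total_open_mono_iff[OF U])
qed

theorem theorem2: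
  fixes A :: "'a::unital_cstar_algebra itself"
  shows "continuous_map (Sigma_space A) (alexandrov (contexts A)) fst \<and>
    sheaf_isomorphic (alexandrov (contexts A)) (internal_spectrum A) (sheaf_of_map (Sigma_space A) fst) \<and>
    frame_isomorphic (sections (internal_spectrum A) (contexts A)) (opens_frame (Sigma_space A))"
proof (intro conjI)
  let ?X = "alexandrov (contexts A)" and ?F = "internal_spectrum A" and ?G = "sheaf_of_map (Sigma_space A) fst"
  show cont: "continuous_map (Sigma_space A) ?X fst"
    by (rule continuous_map_Sigma_fst)
  have "total_open V (restr ?F U V F) = restr ?G U V (total_open U F)" if "V \<subseteq> U" for U V F
    using that by (auto simp: restr_internal_spectrum sheaf_of_map_def total_open_def)
  then show "sheaf_isomorphic ?X ?F ?G"
    unfolding sheaf_isomorphic_def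
    by (intro conjI exI[of _ total_open] poset_sheaf_internal_spectrum poset_sheaf_sheaf_of_map[OF cont])
       (simp_all add: order_iso_total_open)
  have top: "openin ?X (contexts A)"
    by (simp add: openin_alexandrov)
  \<comment> \<open>Every point of the total space lies over a context, so over the largest open set
    the bound on \<open>V\<close> holds for all open sets.\<close>
  have "V \<subseteq> fst -` contexts A" if "openin (Sigma_space A) V" for V
    using openin_subset[OF that] unfolding topspace_Sigma_space by auto
  then have "sections ?G (contexts A) = opens_frame (Sigma_space A)"
    by (auto simp: sheaf_of_map_def opens_frame_def)
  then have iso: "order_iso (sections ?F (contexts A)) (opens_frame (Sigma_space A)) (total_open (contexts A))"
    using order_iso_total_open[OF top] by simp
  moreover have "frame (sections ?F (contexts A))"
    using frame_order_iso[OF iso poset_sheaf.partial_order_sections[OF poset_sheaf_internal_spectrum top]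
        frame_opens_frame] .
  ultimately show "frame_isomorphic (sections ?F (contexts A)) (opens_frame (Sigma_space A))"
    unfolding frame_isomorphic_def using frame_opens_frame by blast
qed

end
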